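(* Let $0\le r\le n$. The composite bijection $\mathrm{Comp}_{r,n}\to\mathrm{Part}_{r,n}$, $\alpha_A\mapsto\lambda_A$ ($A\in\binom{[n]}{r}$), written $\alpha\mapsto\lambda_\alpha$, is described as follows. (1) Each nonempty $\alpha\in\mathrm{Comp}_{r,n}$ can be written as a concatenation $\alpha=d_1\,1^{e_1-1}\,(d_2+1)\,1^{e_2-1}\cdots(d_k+1)\,1^{e_k-1}$ with $d_1,\dots,d_k,e_1,\dots,e_k\ge1$ (if $\alpha$ starts with a maximal run $1^a$, $a\ge 1$, then $d_1=1$ and $e_1=a$). In Frobenius notation the bijection takes $$\alpha\mapsto\lambda_\alpha=\begin{pmatrix}(\sum_{i=1}^kd_i)-1&(\sum_{i=2}^kd_i)-1&\cdots&d_k-1\\(\sum_{i=1}^ke_i)-1&(\sum_{i=2}^ke_i)-1&\cdots&e_k-1\end{pmatrix}.$$ (2) The inverse map $\mathrm{Part}_{r,n}\to\mathrm{Comp}_{r,n}$ takes a nonempty partition $\lambda=\begin{pmatrix}A_1&\cdots&A_k\\L_1&\cdots&L_k\end{pmatrix}$ to $$(A_1-A_2)\,1^{L_1-L_2-1}\,(A_2-A_3+1)\,\cdots\,1^{L_{k-2}-L_{k-1}-1}\,(A_{k-1}-A_k+1)\,1^{L_{k-1}-L_k-1}\,(A_k+2)\,1^{L_k}$$ if $k\ge2$, and to $(A_1+1)\,1^{L_1}$ if $k=1$. Under this bijection, if $\alpha$ corresponds to $\lambda$ then $|\alpha|=\mathrm{OHL}(\lambda)$.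
   Context: $[n]=\{1,\dots,n\}$. $\mathrm{Part}_{r,n}$: partitions contained in an $r\times(n-r)$ rectangle. $\mathrm{Comp}_{r,n}$: the empty composition together with the nonempty compositions $\alpha$ with $\ell(\alpha)\le r$ and $|\alpha|-\ell(\alpha)+1\le n-r$. $1^m$ denotes $m$ consecutive parts equal to $1$. The Frobenius symbol of a partition lists, for each box on the main diagonal from top left to bottom right, its arm length (top row) and leg length (bottom row), the box itself not counted. $\mathrm{OHL}(\lambda)=\lambda_1+\ell(\lambda)-1$ for $\lambda\neq\emptyset$ and $\mathrm{OHL}(\emptyset)=0$. For $A=\{i_1<\cdots<i_r\}\in\binom{[n]}{r}$, $\lambda_A=(i_r-r,\dots,i_2-2,i_1-1)\in\mathrm{Part}_{r,n}$ (a bijection). Write $[r]\setminus A=\{a_k<\cdots<a_1\}$ and $A\setminus[r]=\{b_1<\cdots<b_k\}$, and set $b_0=r$. Let $z_A=\prod_{i=1}^k(b_i\,(b_i-1)\,\cdots\,(b_{i-1}+1)\,a_i)\in S_n$ (a product of disjoint cycles). For $1\le i\le r$ let $B_i$ be the block (cycle support, possibly a singleton) of $z_A$ with $\min B_i=i$. Then $\alpha_A=(|B_{a_k}|-1,|B_{a_k+1}|,\dots,|B_{r-1}|,|B_r|)\in\mathrm{Comp}_{r,n}$ (and $\alpha_{[r]}=\emptyset$); $A\mapsto\alpha_A$ is a bijection $\binom{[n]}{r}\to\mathrm{Comp}_{r,n}$. *)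

theory Defs
  imports "HOL-Combinatorics.Combinatorics"
begin

section \<open>Partitions and compositions\<close>

text \<open>
  Partitions and compositions are lists of positive natural numbers (a partition carries no
  trailing zeros), so the length of the list is the number of parts and \<open>[]\<close> is the empty
  partition or composition.
\<close>

definition Part :: "nat \<Rightarrow> nat \<Rightarrow> nat list set" where
  "Part r n = {lam. sorted_wrt (\<ge>) lam \<and> (\<forall>x\<in>set lam. 1 \<le> x \<and> x \<le> n - r) \<and> length lam \<le> r}"

definition Comp :: "nat \<Rightarrow> nat \<Rightarrow> nat list set" where
  "Comp r n = insert [] {\<alpha>. \<alpha> \<noteq> [] \<and> (\<forall>x\<in>set \<alpha>. 1 \<le> x) \<and>
     length \<alpha> \<le> r \<and> sum_list \<alpha> - length \<alpha> + 1 \<le> n - r}"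

definition OHL :: "nat list \<Rightarrow> nat" where
  "OHL lam = (if lam = [] then 0 else hd lam + length lam - 1)"

text \<open>Boxes are (row, column), both counted from 1.\<close>

definition diagram :: "nat list \<Rightarrow> (nat \<times> nat) set" where
  "diagram lam = {(i, j). 1 \<le> i \<and> i \<le> length lam \<and> 1 \<le> j \<and> j \<le> lam ! (i - 1)}"

definition arm :: "nat list \<Rightarrow> nat \<times> nat \<Rightarrow> nat" where
  "arm lam = (\<lambda>(i, j). card {j'. j < j' \<and> (i, j') \<in> diagram lam})"

definition leg :: "nat list \<Rightarrow> nat \<times> nat \<Rightarrow> nat" where
  "leg lam = (\<lambda>(i, j). card {i'. i < i' \<and> (i', j) \<in> diagram lam})"

text \<open>The pair (top row, bottom row).\<close>

definition frobenius :: "nat list \<Rightarrow> nat list \<times> nat list" where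
  "frobenius lam =
     (let D = sorted_list_of_set {i. (i, i) \<in> diagram lam}
      in (map (\<lambda>i. arm lam (i, i)) D, map (\<lambda>i. leg lam (i, i)) D))"

section \<open>The bijections out of the r-subsets of [n]\<close>

definition rsubsets :: "nat \<Rightarrow> nat \<Rightarrow> nat set set" where
  "rsubsets r n = {A. A \<subseteq> {1..n} \<and> card A = r}"

text \<open>The entry \<open>i\<^sub>j - j\<close> is never negative, as the elements of \<open>A\<close> are positive; zero entries are dropped.\<close>

definition part_of_set :: "nat \<Rightarrow> nat set \<Rightarrow> nat list" where
  "part_of_set r A =
     filter (\<lambda>x. 0 < x) (map (\<lambda>j. sorted_list_of_set A ! (j - 1) - j) (rev [1..<Suc r]))"

text \<open>
  The elements of \<open>[r] - A\<close> are numbered decreasingly and those of \<open>A - [r]\<close> increasingly,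
  both from 1; prepending \<open>r\<close> implements the convention \<open>b\<^sub>0 = r\<close>.
\<close>

definition aelt :: "nat \<Rightarrow> nat set \<Rightarrow> nat \<Rightarrow> nat" where
  "aelt r A i = rev (sorted_list_of_set ({1..r} - A)) ! (i - 1)"

definition belt :: "nat \<Rightarrow> nat set \<Rightarrow> nat \<Rightarrow> nat" where
  "belt r A i = (r # sorted_list_of_set (A - {1..r})) ! i"

text \<open>The \<open>i\<close>-th factor is the cycle \<open>(b\<^sub>i (b\<^sub>i - 1) \<dots> (b\<^sub>i\<^sub>-\<^sub>1 + 1) a\<^sub>i)\<close>.\<close>

definition zperm :: "nat \<Rightarrow> nat set \<Rightarrow> nat \<Rightarrow> nat" where
  "zperm r A =
     foldr (\<circ>)
       (map (\<lambda>i. cycle_of_list (rev [Suc (belt r A (i - 1))..<Suc (belt r A i)] @ [aelt r A i]))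
         [1..<Suc (card ({1..r} - A))])
       id"

text \<open>Blocks are orbits on \<open>[n]\<close>, so that fixed points give singleton blocks.\<close>

definition blocks :: "nat \<Rightarrow> nat \<Rightarrow> nat set \<Rightarrow> nat set set" where
  "blocks r n A = orbit (zperm r A) ` {1..n}"

definition block :: "nat \<Rightarrow> nat \<Rightarrow> nat set \<Rightarrow> nat \<Rightarrow> nat set" where
  "block r n A i = (THE B. B \<in> blocks r n A \<and> Min B = i)"

definition comp_of_set :: "nat \<Rightarrow> nat \<Rightarrow> nat set \<Rightarrow> nat list" where
  "comp_of_set r n A =
     (if A = {1..r} then []
      else let m = aelt r A (card ({1..r} - A))
           in (card (block r n A m) - 1) # map (\<lambda>i. card (block r n A i)) [Suc m..<Suc r])"

definition comp_to_part :: "nat \<Rightarrow> nat \<Rightarrow> nat list \<Rightarrow> nat list" where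
  "comp_to_part r n \<alpha> = part_of_set r (the_inv_into (rsubsets r n) (comp_of_set r n) \<alpha>)"

definition part_to_comp :: "nat \<Rightarrow> nat \<Rightarrow> nat list \<Rightarrow> nat list" where
  "part_to_comp r n = the_inv_into (Comp r n) (comp_to_part r n)"

section \<open>The two explicit descriptions\<close>

text \<open>The indices of \<open>d\<close>, \<open>e\<close> and of \<open>A\<close>, \<open>L\<close> below run over \<open>1, \<dots>, k\<close>.\<close>

definition is_decomposition :: "nat list \<Rightarrow> nat \<Rightarrow> (nat \<Rightarrow> nat) \<Rightarrow> (nat \<Rightarrow> nat) \<Rightarrow> bool" where
  "is_decomposition \<alpha> k d e \<longleftrightarrow>
     1 \<le> k \<and> (\<forall>i\<in>{1..k}. 1 \<le> d i \<and> 1 \<le> e i) \<and>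
     \<alpha> = d 1 # replicate (e 1 - 1) 1 @
         concat (map (\<lambda>i. (d i + 1) # replicate (e i - 1) 1) [2..<Suc k])"

text \<open>
  Both rows of a Frobenius symbol are strictly decreasing, so the subtractions do not truncate.
\<close>

definition comp_of_frobenius :: "nat \<Rightarrow> (nat \<Rightarrow> nat) \<Rightarrow> (nat \<Rightarrow> nat) \<Rightarrow> nat list" where
  "comp_of_frobenius k A L =
     (if k = 1 then (A 1 + 1) # replicate (L 1) 1
      else (A 1 - A 2) # replicate (L 1 - L 2 - 1) 1 @
           concat (map (\<lambda>i. (A i - A (i + 1) + 1) # replicate (L i - L (i + 1) - 1) 1) [2..<k]) @
           (A k + 2) # replicate (L k) 1)"

end

theory Submission
  imports Defs
begin

text \<open>
  A nonempty composition is recorded by its runs: a pair of lists of positive numbers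
  \<open>d\<^sub>1, \<dots>, d\<^sub>k\<close> and \<open>e\<^sub>1, \<dots>, e\<^sub>k\<close>, as in part (1). Let \<open>D\<^sub>j\<close> and \<open>E\<^sub>j\<close> be the sums of the \<open>d\<^sub>i\<close>
  and of the \<open>e\<^sub>i\<close> over \<open>i \<ge> j\<close>. The same pair encodes the set \<open>A\<close> in which the missing elements of
  \<open>[r]\<close> are the \<open>r + 1 - E\<^sub>j\<close> and the elements beyond \<open>r\<close> are the \<open>r + D\<^sub>j\<close>. The block of \<open>z\<^sub>A\<close> with minimum
  \<open>r + 1 - E\<^sub>j\<close> consists of that number and an interval of length \<open>D\<^sub>j - D\<^sub>j\<^sub>+\<^sub>1 = d\<^sub>j\<close>, and all other
  elements of \<open>[r]\<close> are fixed points; this makes \<open>\<alpha>\<^sub>A\<close> the given composition.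
  On the other side, the arm of the \<open>j\<close>-th diagonal box of \<open>\<lambda>\<^sub>A\<close> is the \<open>j\<close>-th largest element of \<open>A\<close>
  minus \<open>r + 1\<close>, and its leg is \<open>r\<close> minus the \<open>j\<close>-th smallest missing element, that is,
  \<open>D\<^sub>j - 1\<close> and \<open>E\<^sub>j - 1\<close>.
\<close>

section \<open>Suffix sums of lists of positive numbers\<close>

fun suffix_sums :: "nat list \<Rightarrow> nat list" where
  "suffix_sums [] = []"
| "suffix_sums (x # xs) = (x + sum_list xs) # suffix_sums xs"

lemma length_suffix_sums [simp]: "length (suffix_sums xs) = length xs"
  by (induction xs) auto

lemma nth_suffix_sums: "i < length xs \<Longrightarrow> suffix_sums xs ! i = sum_list (drop i xs)"
  by (induction xs arbitrary: i) (auto simp: nth_Cons split: nat.split)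

lemma set_suffix_sums:
  assumes "\<forall>x\<in>set xs. 0 < x"
  shows "set (suffix_sums xs) \<subseteq> {1..sum_list xs}"
  using assms by (induction xs) force+

lemma sorted_wrt_suffix_sums:
  assumes "\<forall>x\<in>set xs. 0 < x"
  shows "sorted_wrt (>) (suffix_sums xs)"
  using assms
proof (induction xs)
  case (Cons x xs)
  then show ?case using set_suffix_sums[of xs] by fastforce
qed simp

lemma suffix_sums_inject: "suffix_sums xs = suffix_sums ys \<longleftrightarrow> xs = ys"
proof
  assume eq: "suffix_sums xs = suffix_sums ys"
  then have "length xs = length ys" by (metis length_suffix_sums)
  then show "xs = ys" using eq by (induction xs ys rule: list_induct2) auto
qed simp

text \<open>The preimage consists of the consecutive differences of \<open>ys\<close>, with the last
  entry kept; strict decrease makes them positive.\<close>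

lemma suffix_sums_surj:
  assumes "sorted_wrt (>) ys" "\<forall>y\<in>set ys. 0 < y"
  obtains xs where "\<forall>x\<in>set xs. 0 < x" "suffix_sums xs = ys"
proof -
  from assms have "\<exists>xs. (\<forall>x\<in>set xs. 0 < x) \<and> suffix_sums xs = ys"
  proof (induction ys)
    case Nil
    then show ?case by (intro exI[of _ "[]"]) simp
  next
    case (Cons y ys)
    then obtain xs where xs: "\<forall>x\<in>set xs. 0 < x" "suffix_sums xs = ys" by auto
    \<comment> \<open>The sum of \<open>xs\<close> is the first entry of \<open>ys\<close>, or 0 if
      \<open>ys\<close> is empty.\<close>
    have "sum_list xs < y"
      using xs Cons.prems by (cases xs) auto
    then show ?case using xs
      by (intro exI[of _ "(y - sum_list xs) # xs"]) auto
  qed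
  then show thesis using that by blast
qed

section \<open>Runs of a composition\<close>

text \<open>For the set A of the overview this lists the full block sizes with minima from
  \<open>r + 1 - E_1\<close> up to r. Treating the first run like all others keeps the inductions
  uniform; its correction is left to \<open>dec_hd\<close>.\<close>

definition run_blocks :: "nat list \<Rightarrow> nat list \<Rightarrow> nat list" where
  "run_blocks ds es = concat (map2 (\<lambda>d e. Suc d # replicate (e - 1) 1) ds es)"

lemma run_blocks_Nil [simp]: "run_blocks [] [] = []"
  by (simp add: run_blocks_def)

lemma run_blocks_Cons [simp]:
  "run_blocks (d # ds) (e # es) = Suc d # replicate (e - 1) 1 @ run_blocks ds es"
  by (simp add: run_blocks_def)

lemma length_run_blocks:
  assumes "length ds = length es" "\<forall>e\<in>set es. 0 < e"
  shows "length (run_blocks ds es) = sum_list es"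
  using assms by (induction ds es rule: list_induct2) auto

lemma sum_list_run_blocks:
  assumes "length ds = length es" "\<forall>e\<in>set es. 0 < e"
  shows "sum_list (run_blocks ds es) = sum_list ds + sum_list es"
  using assms by (induction ds es rule: list_induct2) (auto simp: sum_list_replicate)

lemma run_blocks_pos:
  assumes "length ds = length es"
  shows "\<forall>x\<in>set (run_blocks ds es). 0 < x"
  using assms by (induction ds es rule: list_induct2) auto

text \<open>The initial run of \<open>x\<close> is maximal on both sides, so
  \<open>takeWhile\<close> recovers its length from the whole list.\<close>

lemma replicate_append_inject:
  assumes "replicate a x @ xs = replicate b x @ ys"
    "xs = [] \<or> hd xs \<noteq> x" "ys = [] \<or> hd ys \<noteq> x"
  shows "a = b \<and> xs = ys"
proof -
  have "takeWhile ((=) x) (replicate c x @ zs) = replicate c x" if "zs = [] \<or> hd zs \<noteq> x" for c zs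
    using that by (induction c) (auto simp: takeWhile_eq_Nil_iff)
  from this[OF assms(2), of a] this[OF assms(3), of b] assms(1)
  have "a = b" by (metis length_replicate)
  with assms(1) show ?thesis by simp
qed

lemma hd_run_blocks_ne_1:
  assumes "length ds = length es" "\<forall>d\<in>set ds. 0 < d"
  shows "run_blocks ds es = [] \<or> hd (run_blocks ds es) \<noteq> 1"
  using assms by (cases ds; cases es) auto

text \<open>Peel off one run at a time: the head gives d, and the ones after it give e, because the
  next run, if any, starts with an entry of at least 2.\<close>

lemma run_blocks_inject:
  assumes "length ds = length es" "length ds' = length es'"
    "\<forall>d\<in>set ds. 0 < d" "\<forall>d\<in>set ds'. 0 < d" "\<forall>e\<in>set es. 0 < e" "\<forall>e\<in>set es'. 0 < e"
    "run_blocks ds es = run_blocks ds' es'"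
  shows "ds = ds' \<and> es = es'"
  using assms
proof (induction ds es arbitrary: ds' es' rule: list_induct2)
  case Nil
  then show ?case by (cases ds'; cases es') auto
next
  case (Cons d ds e es)
  then obtain d' ds2 e' es2 where [simp]: "ds' = d' # ds2" "es' = e' # es2"
    by (cases ds'; cases es') auto
  have "e - 1 = e' - 1 \<and> run_blocks ds es = run_blocks ds2 es2"
    using Cons hd_run_blocks_ne_1[of ds es] hd_run_blocks_ne_1[of ds2 es2]
    by (intro replicate_append_inject[of _ 1]) auto
  \<comment> \<open>Subtraction truncates, so \<open>e - 1 = e' - 1\<close> alone would not separate
    0 from 1.\<close>
  moreover have "0 < e" "0 < e'" using Cons.prems by auto
  ultimately show ?case using Cons.prems Cons.IH[of ds2 es2] by auto
qed

lemma run_blocks_surj: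
  assumes "\<forall>x\<in>set xs. 0 < x" "xs = [] \<or> hd xs \<noteq> 1"
  obtains ds es where "length ds = length es" "\<forall>d\<in>set ds. 0 < d" "\<forall>e\<in>set es. 0 < e"
    "run_blocks ds es = xs"
proof -
  \<comment> \<open>The induction must allow m leading ones that belong to no run yet. The next
    entry greater than 1 on their left absorbs them into a run with e = m + 1; the condition on the
    head of \<open>xs\<close> finally gives m = 0.\<close>
  have "\<exists>m ds es. length ds = length es \<and> (\<forall>d\<in>set ds. 0 < d) \<and> (\<forall>e\<in>set es. 0 < e) \<and>
      xs = replicate m 1 @ run_blocks ds es"
    using assms(1)
  proof (induction xs)
    case Nil
    then show ?case by (intro exI[of _ 0] exI[of _ "[]"] exI[of _ "[]"]) simp
  next
    case (Cons x xs)
    from Cons.prems have "\<forall>x\<in>set xs. 0 < x" by simp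
    with Cons.IH obtain m ds es where *: "length ds = length es" "\<forall>d\<in>set ds. 0 < d" "\<forall>e\<in>set es. 0 < e"
      "xs = replicate m 1 @ run_blocks ds es" by blast
    show ?case
    proof (cases "x = 1")
      case True
      with * have "x # xs = replicate (Suc m) 1 @ run_blocks ds es" by simp
      then show ?thesis using *(1-3) by (intro exI conjI)
    next
      case False
      with Cons.prems have x: "1 < x" by (simp add: nat_neq_iff)
      have "length ((x - 1) # ds) = length (Suc m # es)" using *(1) by simp
      moreover have "\<forall>d\<in>set ((x - 1) # ds). 0 < d" using *(2) x by simp
      moreover have "\<forall>e\<in>set (Suc m # es). 0 < e" using *(3) by simp
      moreover have "x # xs = replicate 0 1 @ run_blocks ((x - 1) # ds) (Suc m # es)"
        using *(4) x by simp
      ultimately show ?thesis by (intro exI conjI)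
    qed
  qed
  then obtain m ds es where *: "length ds = length es" "\<forall>d\<in>set ds. 0 < d" "\<forall>e\<in>set es. 0 < e"
      "xs = replicate m 1 @ run_blocks ds es" by blast
  with assms(2) have "m = 0" by (cases m) auto
  with * that show thesis by simp
qed

text \<open>
  The first block loses its minimum in \<open>\<alpha>\<^sub>A\<close>, which is why the first run contributes \<open>d\<^sub>1\<close> and every
  later one \<open>d\<^sub>i + 1\<close>.
\<close>

fun dec_hd :: "nat list \<Rightarrow> nat list" where
  "dec_hd [] = []"
| "dec_hd (x # xs) = (x - 1) # xs"

text \<open>For a nonempty composition \<alpha> with these runs, the e-sum is the length of \<alpha>
  and the d-sum is |\<alpha>| minus the length plus 1. The two bounds are therefore those in
  \<open>Comp\<close>.\<close>

definition runs :: "nat \<Rightarrow> nat \<Rightarrow> (nat list \<times> nat list) set" where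
  "runs r n = {(ds, es). length ds = length es \<and> (\<forall>d\<in>set ds. 0 < d) \<and> (\<forall>e\<in>set es. 0 < e) \<and>
     sum_list ds \<le> n - r \<and> sum_list es \<le> r}"

definition comp_of_runs :: "nat list \<times> nat list \<Rightarrow> nat list" where
  "comp_of_runs = (\<lambda>(ds, es). dec_hd (run_blocks ds es))"

lemma length_dec_hd [simp]: "length (dec_hd xs) = length xs"
  by (cases xs) auto

lemma dec_hd_inject:
  assumes "\<forall>x\<in>set xs. 0 < x" "\<forall>y\<in>set ys. 0 < y" "dec_hd xs = dec_hd ys"
  shows "xs = ys"
  using assms by (cases xs; cases ys) auto

lemma sum_list_comp_of_runs:
  assumes "(ds, es) \<in> runs r n"
  shows "sum_list (comp_of_runs (ds, es)) = sum_list ds + sum_list es - 1"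
proof -
  have "sum_list (dec_hd xs) = sum_list xs - 1" if "\<forall>x\<in>set xs. 0 < x" for xs
    using that by (cases xs) auto
  with assms show ?thesis
    using run_blocks_pos[of ds es] sum_list_run_blocks[of ds es]
    by (auto simp: comp_of_runs_def runs_def)
qed

lemma inj_on_comp_of_runs: "inj_on comp_of_runs (runs r n)"
proof (rule inj_onI)
  fix p q
  assume 1: "p \<in> runs r n" "q \<in> runs r n" and 2: "comp_of_runs p = comp_of_runs q"
  obtain ds es ds' es' where pq: "p = (ds, es)" "q = (ds', es')"
    by (cases p; cases q)
  from 1 have len: "length ds = length es" "length ds' = length es'"
    by (simp_all add: pq runs_def)
  have "run_blocks ds es = run_blocks ds' es'"
    by (rule dec_hd_inject[OF run_blocks_pos[OF len(1)] run_blocks_pos[OF len(2)]])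
      (use 2 in \<open>simp add: pq comp_of_runs_def\<close>)
  with 1 len have "ds = ds' \<and> es = es'"
    by (intro run_blocks_inject) (simp_all add: pq runs_def)
  then show "p = q" by (simp add: pq)
qed

lemma bij_betw_comp_of_runs: "bij_betw comp_of_runs (runs r n) (Comp r n)"
  unfolding bij_betw_def
proof
  show "inj_on comp_of_runs (runs r n)" by (rule inj_on_comp_of_runs)
  have "comp_of_runs (ds, es) \<in> Comp r n" if *: "(ds, es) \<in> runs r n" for ds es
  proof (cases ds)
    case Nil
    with * show ?thesis by (auto simp: Comp_def comp_of_runs_def runs_def)
  next
    case (Cons d ds')
    with * obtain e es' where es: "es = e # es'" by (cases es) (auto simp: runs_def)
    have "0 < x" if "x \<in> set (comp_of_runs (ds, es))" for x
      using that * run_blocks_pos[of ds' es'] by (auto simp: Cons es comp_of_runs_def runs_def)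
    moreover have "length (comp_of_runs (ds, es)) = sum_list es"
      using * length_run_blocks[of ds es] by (auto simp: comp_of_runs_def runs_def)
    moreover note sum_list_comp_of_runs[OF *]
    ultimately show ?thesis
      using * by (force simp: Comp_def runs_def Cons es Suc_le_eq)
  qed
  moreover have "\<alpha> \<in> comp_of_runs ` runs r n" if "\<alpha> \<in> Comp r n" for \<alpha>
  proof (cases \<alpha>)
    case Nil
    have "([], []) \<in> runs r n" "comp_of_runs ([], []) = []"
      by (auto simp: runs_def comp_of_runs_def)
    with Nil show ?thesis by (metis imageI)
  next
    case (Cons x xs)
    have "x > 0" "\<forall>x\<in>set xs. 0 < x" using that by (auto simp: Cons Comp_def Suc_le_eq)
    \<comment> \<open>Raising the first part by one undoes \<open>dec_hd\<close> and makes the head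
      at least 2, as \<open>run_blocks_surj\<close> requires.\<close>
    then obtain ds es where *: "length ds = length es" "\<forall>d\<in>set ds. 0 < d" "\<forall>e\<in>set es. 0 < e"
      "run_blocks ds es = Suc x # xs"
      by (elim run_blocks_surj[of "Suc x # xs", rotated 2]) auto
    have len: "sum_list es = Suc (length xs)" and sum: "sum_list ds + sum_list es = Suc x + sum_list xs"
      using length_run_blocks[of ds es] sum_list_run_blocks[of ds es] * by auto
    have "(ds, es) \<in> runs r n"
      using that * len sum by (auto simp: Comp_def runs_def Cons)
    moreover have "comp_of_runs (ds, es) = \<alpha>"
      using * by (simp add: comp_of_runs_def Cons)
    ultimately show ?thesis by (metis imageI)
  qed
  ultimately show "comp_of_runs ` runs r n = Comp r n" by auto
qed

section \<open>The set with given runs\<close>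

definition set_of_runs :: "nat \<Rightarrow> nat list \<times> nat list \<Rightarrow> nat set" where
  "set_of_runs r = (\<lambda>(ds, es).
     {1..r} - (\<lambda>x. Suc r - x) ` set (suffix_sums es) \<union> (+) r ` set (suffix_sums ds))"

context
  fixes r n ds es
  assumes runs: "(ds, es) \<in> runs r n"
begin

lemma runs_suffix_sums:
  "set (suffix_sums ds) \<subseteq> {1..n - r}" "set (suffix_sums es) \<subseteq> {1..r}"
  using runs set_suffix_sums[of ds] set_suffix_sums[of es] by (fastforce simp: runs_def)+

lemma initial_diff_set_of_runs:
  "{1..r} - set_of_runs r (ds, es) = (\<lambda>x. Suc r - x) ` set (suffix_sums es)"
  using runs_suffix_sums by (force simp: set_of_runs_def)

lemma set_of_runs_diff_initial:
  "set_of_runs r (ds, es) - {1..r} = (+) r ` set (suffix_sums ds)"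
  using runs_suffix_sums by (force simp: set_of_runs_def)

text \<open>The suffix sums decrease and the reflection at r + 1 reverses the order, so no
  \<open>rev\<close> appears here, in contrast to the elements beyond r.\<close>

lemma sorted_list_initial_diff_set_of_runs:
  "sorted_list_of_set ({1..r} - set_of_runs r (ds, es)) = map (\<lambda>x. Suc r - x) (suffix_sums es)"
proof (rule strict_sorted_equal)
  have "sorted_wrt (>) (suffix_sums es)"
    using runs by (intro sorted_wrt_suffix_sums) (auto simp: runs_def)
  then show "sorted_wrt (<) (map (\<lambda>x. Suc r - x) (suffix_sums es))"
    unfolding sorted_wrt_map
    by (rule sorted_wrt_mono_rel[rotated]) (use runs_suffix_sums in force)
qed (simp_all add: initial_diff_set_of_runs del: One_nat_def)

lemma sorted_list_set_of_runs_diff_initial: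
  "sorted_list_of_set (set_of_runs r (ds, es) - {1..r}) = rev (map ((+) r) (suffix_sums ds))"
proof (rule strict_sorted_equal)
  have "sorted_wrt (>) (suffix_sums ds)"
    using runs by (intro sorted_wrt_suffix_sums) (auto simp: runs_def)
  then show "sorted_wrt (<) (rev (map ((+) r) (suffix_sums ds)))"
    by (simp add: sorted_wrt_rev sorted_wrt_map)
qed (simp_all add: set_of_runs_diff_initial del: One_nat_def)

text \<open>As many elements are removed from [r] as are added beyond r, since \<open>ds\<close> and
  \<open>es\<close> have equal length.\<close>

lemma set_of_runs_mem_rsubsets:
  assumes "r \<le> n"
  shows "set_of_runs r (ds, es) \<in> rsubsets r n"
proof -
  define A where "A = set_of_runs r (ds, es)"
  have sub: "A \<subseteq> {1..n}"
    using runs_suffix_sums assms by (force simp: A_def set_of_runs_def)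
  then have fin: "finite A" using finite_subset by blast
  have "card (A - {1..r}) = card ({1..r} - A)"
    using sorted_list_initial_diff_set_of_runs sorted_list_set_of_runs_diff_initial runs
    unfolding A_def runs_def
    by (metis (mono_tags, lifting) case_prodD length_map length_rev length_sorted_list_of_set
        length_suffix_sums mem_Collect_eq)
  then have "card A = card {1..r}"
    using card_Int_Diff[OF fin, of "{1..r}"] card_Int_Diff[of "{1..r}" A] by (simp add: Int_commute)
  with sub show ?thesis by (simp add: A_def rsubsets_def)
qed

end

lemma card_diff_sym:
  assumes "finite A" "finite B" "card A = card B"
  shows "card (A - B) = card (B - A)"
  using card_Int_Diff[OF assms(1), of B] card_Int_Diff[OF assms(2), of A] assms(3)
  by (simp add: Int_commute)

text \<open>A set is determined by its elements beyond r and its missing elements of [r]. Their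
  sorted lists, shifted or reflected, are the strictly decreasing lists D and E, which correspond to
  \<open>ds\<close> and \<open>es\<close> by taking differences.\<close>

lemma bij_betw_set_of_runs:
  assumes "r \<le> n"
  shows "bij_betw (set_of_runs r) (runs r n) (rsubsets r n)"
  unfolding bij_betw_def
proof
  show "inj_on (set_of_runs r) (runs r n)"
    unfolding inj_on_def
  proof clarify
    fix ds es ds' es'
    assume 1: "(ds, es) \<in> runs r n" "(ds', es') \<in> runs r n"
      and 2: "set_of_runs r (ds, es) = set_of_runs r (ds', es')"
    have "map ((+) r) (suffix_sums ds) = map ((+) r) (suffix_sums ds')"
      using 1 2 sorted_list_set_of_runs_diff_initial by (metis rev_is_rev_conv)
    then have "ds = ds'" by (simp add: suffix_sums_inject inj_map_eq_map)
    have "map (\<lambda>x. Suc r - x) (suffix_sums es) = map (\<lambda>x. Suc r - x) (suffix_sums es')"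
      using 1 2 sorted_list_initial_diff_set_of_runs by metis
    \<comment> \<open>Truncated subtraction is injective only on a bounded range; all suffix sums of
      \<open>es\<close> lie in {1..r}.\<close>
    moreover have "inj_on (\<lambda>x. Suc r - x) (set (suffix_sums es) \<union> set (suffix_sums es'))"
    proof (rule inj_on_subset)
      show "inj_on (\<lambda>x. Suc r - x) {1..r}" by (auto intro!: inj_onI)
      show "set (suffix_sums es) \<union> set (suffix_sums es') \<subseteq> {1..r}"
        using runs_suffix_sums(2)[OF 1(1)] runs_suffix_sums(2)[OF 1(2)] by blast
    qed
    ultimately have "es = es'" using map_inj_on suffix_sums_inject by blast
    with \<open>ds = ds'\<close> show "ds = ds' \<and> es = es'" by simp
  qed
  have "A \<in> set_of_runs r ` runs r n" if "A \<in> rsubsets r n" for A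
  proof -
    have A: "A \<subseteq> {1..n}" "card A = r" "finite A"
      using that by (auto simp: rsubsets_def intro: finite_subset)
    \<comment> \<open>\<open>bs\<close> and \<open>cs\<close> are the prospective lists D and E,
      both in decreasing order.\<close>
    define bs where "bs = map (\<lambda>x. x - r) (rev (sorted_list_of_set (A - {1..r})))"
    define cs where "cs = map (\<lambda>x. Suc r - x) (sorted_list_of_set ({1..r} - A))"
    have "sorted_wrt (\<lambda>x y. x - r > y - r) (rev (sorted_list_of_set (A - {1..r})))"
      unfolding sorted_wrt_rev
      by (rule sorted_wrt_mono_rel[of _ "(<)"]) (use A in auto)
    moreover have "\<forall>x\<in>set bs. 0 < x" using A by (auto simp: bs_def)
    ultimately obtain ds where ds: "\<forall>x\<in>set ds. 0 < x" "suffix_sums ds = bs"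
      using suffix_sums_surj[of bs] by (auto simp: bs_def sorted_wrt_map)
    have "sorted_wrt (\<lambda>x y. Suc r - x > Suc r - y) (sorted_list_of_set ({1..r} - A))"
      by (rule sorted_wrt_mono_rel[of _ "(<)"]) (use A in auto)
    moreover have "\<forall>x\<in>set cs. 0 < x" using A by (auto simp: cs_def)
    ultimately obtain es where es: "\<forall>x\<in>set es. 0 < x" "suffix_sums es = cs"
      using suffix_sums_surj[of cs] by (auto simp: cs_def sorted_wrt_map)
    have "length bs = length cs"
      using A card_diff_sym[of A "{1..r}"] by (simp add: bs_def cs_def)
    then have "length ds = length es" using ds es by (metis length_suffix_sums)
    moreover have "sum_list ds \<le> n - r"
    proof (cases ds)
      case (Cons d ds')
      \<comment> \<open>The total is the first suffix sum, so it inherits the bound that holds for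
        every entry of \<open>bs\<close>.\<close>
      then have "sum_list ds \<in> set bs" using ds(2) by auto
      with A show ?thesis by (auto simp: bs_def dest!: subsetD)
    qed simp
    moreover have "sum_list es \<le> r"
    proof (cases es)
      case (Cons d es')
      then have "sum_list es \<in> set cs" using es(2) by auto
      with A show ?thesis by (auto simp: cs_def)
    qed simp
    ultimately have "(ds, es) \<in> runs r n" using ds es by (simp add: runs_def)
    moreover have "set_of_runs r (ds, es) = A"
    proof -
      have "(\<lambda>x. Suc r - x) ` set cs = {1..r} - A"
        using A by (force simp: cs_def image_image)
      moreover have "(+) r ` set bs = A - {1..r}"
        using A by (force simp: bs_def image_image)
      ultimately show ?thesis using ds es by (auto simp: set_of_runs_def)
    qed
    ultimately show ?thesis by (metis imageI)
  qed
  then show "set_of_runs r ` runs r n = rsubsets r n"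
    using set_of_runs_mem_rsubsets[OF _ assms] by auto
qed

section \<open>Blocks of the permutation\<close>

lemma foldr_comp_Cons: "foldr (\<circ>) (f # fs) g x = f (foldr (\<circ>) fs g x)"
  by simp

lemma foldr_cycles_outside:
  assumes "x \<notin> set (concat css)"
  shows "foldr (\<circ>) (map cycle_of_list css) id x = x"
  using assms by (induction css) (auto simp: id_outside_supp)

text \<open>The cycles applied before \<open>cs\<close> fix \<open>x\<close>; those applied after it
  fix the image of \<open>x\<close>, which still lies in \<open>cs\<close>.\<close>

lemma foldr_cycles_inside:
  assumes "distinct (concat css)" "cs \<in> set css" "x \<in> set cs"
  shows "foldr (\<circ>) (map cycle_of_list css) id x = cycle_of_list cs x"
  using assms
proof (induction css)
  case (Cons c css)
  show ?case
  proof (cases "cs \<in> set css")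
    case True
    have IH: "foldr (\<circ>) (map cycle_of_list css) id x = cycle_of_list cs x"
      by (rule Cons.IH) (use Cons.prems True in auto)
    have "cycle_of_list cs x \<in> set cs"
      using cycle_permutes Cons.prems(3) by (metis permutes_in_image)
    then have "cycle_of_list cs x \<notin> set c" using Cons.prems(1) True by auto
    with IH show ?thesis
      by (simp only: list.map foldr_comp_Cons id_outside_supp not_False_eq_True)
  next
    case False
    with Cons.prems have "cs = c" by simp
    with Cons.prems have "x \<notin> set (concat css)" by auto
    then show ?thesis
      by (simp only: list.map foldr_comp_Cons foldr_cycles_outside \<open>cs = c\<close> not_False_eq_True)
  qed
qed simp

lemma permutation_foldr_cycles: "permutation (foldr (\<circ>) (map cycle_of_list css) id)"
proof (induction css)
  case (Cons cs css)
  have "foldr (\<circ>) (map cycle_of_list (cs # css)) id =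
      cycle_of_list cs \<circ> foldr (\<circ>) (map cycle_of_list css) id"
    by (rule ext) simp
  then show ?case
    using permutation_compose[OF permutation_of_cycle Cons.IH] by metis
qed (simp add: permutation_id)

lemma orbit_cycle_of_list:
  assumes "distinct cs" "x \<in> set cs"
  shows "orbit (cycle_of_list cs) x = set cs"
proof -
  let ?l = "length cs"
  obtain i where i: "i < ?l" "x = cs ! i" using assms(2) by (metis in_set_conv_nth)
  have pow: "(cycle_of_list cs ^^ m) x = cs ! ((i + m) mod ?l)" for m
    using arg_cong[OF cyclic_rotation[OF assms(1), of m], of "\<lambda>l. l ! i"] i
    by (simp add: nth_rotate add.commute)
  have "cs ! j \<in> orbit (cycle_of_list cs) x" if "j < ?l" for j
  proof -
    \<comment> \<open>Adding a full turn \<open>?l\<close> avoids truncation and keeps the exponent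
      positive, as membership in an orbit demands.\<close>
    have "(cycle_of_list cs ^^ (?l + j - i)) x = cs ! j"
      using i(1) that by (simp add: pow)
    moreover have "0 < ?l + j - i" using i(1) by simp
    ultimately show ?thesis unfolding orbit_altdef by (intro CollectI exI[of _ "?l + j - i"]) simp
  qed
  then have "set cs \<subseteq> orbit (cycle_of_list cs) x" by (auto simp: in_set_conv_nth)
  moreover have "orbit (cycle_of_list cs) x \<subseteq> set cs"
    using i(1) by (auto simp: orbit_altdef pow intro!: nth_mem mod_less_divisor)
  ultimately show ?thesis by blast
qed

text \<open>The product agrees with the single cycle on the support of the latter, which that cycle
  leaves invariant, so the two orbits coincide.\<close>

lemma orbit_foldr_cycles:
  assumes "distinct (concat css)" "cs \<in> set css" "x \<in> set cs"
  shows "orbit (foldr (\<circ>) (map cycle_of_list css) id) x = set cs"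
proof -
  have "distinct cs" using assms(1,2) by (simp add: distinct_concat_iff)
  then have "orbit (cycle_of_list cs) x = set cs" using assms(3) by (rule orbit_cycle_of_list)
  moreover have "orbit (cycle_of_list cs) x = orbit (foldr (\<circ>) (map cycle_of_list css) id) x"
  proof (rule orbit_cong0[OF assms(3)])
    show "cycle_of_list cs \<in> set cs \<rightarrow> set cs"
      using cycle_permutes permutes_in_image by fastforce
  qed (simp add: foldr_cycles_inside[OF assms(1,2)])
  ultimately show ?thesis by simp
qed

text \<open>Resolves the definite description in \<open>block\<close>: an orbit contains its
  minimum, so two orbits with the same minimum meet and are equal.\<close>

lemma block_eq_orbit:
  assumes "permutation (zperm r A)" "i \<in> {1..n}" "Min (orbit (zperm r A) i) = i"
  shows "block r n A i = orbit (zperm r A) i"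
  unfolding block_def blocks_def
proof (rule the_equality)
  show "orbit (zperm r A) i \<in> orbit (zperm r A) ` {1..n} \<and> Min (orbit (zperm r A) i) = i"
    using assms by blast
next
  fix B assume B: "B \<in> orbit (zperm r A) ` {1..n} \<and> Min B = i"
  then obtain x where x: "B = orbit (zperm r A) x" by auto
  have self: "s \<in> orbit (zperm r A) s" for s
    using assms(1) by (rule permutation_self_in_orbit)
  have "i \<in> orbit (zperm r A) x"
    using B x Min_in[OF finite_orbit[OF self] orbit_nonempty] by metis
  moreover from this have "x \<in> orbit (zperm r A) i" by (rule orbit_swap[OF self])
  ultimately show "B = orbit (zperm r A) i" unfolding x by (blast intro: orbit_trans)
qed

lemma distinct_concat_map:
  assumes "distinct xs" "\<And>x. x \<in> set xs \<Longrightarrow> distinct (g x)"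
    "\<And>x y. x \<in> set xs \<Longrightarrow> y \<in> set xs \<Longrightarrow> x \<noteq> y \<Longrightarrow> set (g x) \<inter> set (g y) = {}"
  shows "distinct (concat (map g xs))"
  using assms
proof (induction xs)
  case (Cons a xs)
  have "distinct (concat (map g xs))" using Cons by simp
  moreover have "set (g a) \<inter> set (g x) = {}" if "x \<in> set xs" for x
    using that Cons.prems by force
  ultimately show ?case using Cons.prems(2) by auto
qed simp

lemma sum_list_drop_strict_mono:
  assumes "\<forall>x\<in>set xs. 0 < (x::nat)" "i < j" "j \<le> length xs"
  shows "sum_list (drop j xs) < sum_list (drop i xs)"
proof -
  have "drop i xs = xs ! i # drop (Suc i) xs" using assms by (simp add: Cons_nth_drop_Suc)
  moreover have "0 < xs ! i" using assms by simp
  moreover have "sum_list (drop j xs) \<le> sum_list (drop (Suc i) xs)"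
    using sum_list_append[of "take (j - Suc i) (drop (Suc i) xs)" "drop j xs"] assms(2,3)
    by (metis Suc_leI append_take_drop_id drop_drop le_add2 le_add_diff_inverse2)
  ultimately show ?thesis by simp
qed

text \<open>Here \<open>f\<close> stands for the block size as a function of the minimum. The range
  is cut at the missing elements \<open>r + 1 - E_j\<close>; each piece starts with a nontrivial
  block and continues with fixed points, which is one run.\<close>

lemma map_eq_run_blocks:
  assumes "length ds = length es" "\<forall>e\<in>set es. 0 < e" "sum_list es \<le> r"
    "\<And>j. j < length ds \<Longrightarrow> f (Suc r - suffix_sums es ! j) = Suc (ds ! j)"
    "\<And>i. Suc r - sum_list es \<le> i \<Longrightarrow> i \<le> r \<Longrightarrow> Suc r - i \<notin> set (suffix_sums es) \<Longrightarrow> f i = 1"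
  shows "map f [Suc r - sum_list es..<Suc r] = run_blocks ds es"
  using assms
proof (induction ds es rule: list_induct2)
  case (Cons d ds e es)
  define m where "m = Suc r - (e + sum_list es)"
  have m: "0 < e" "m + e + sum_list es = Suc r" using Cons.prems by (auto simp: m_def)
  have notin: "x \<notin> set (suffix_sums es)" if "sum_list es < x" for x
    using that set_suffix_sums[of es] Cons.prems(1) by (auto dest!: subsetD)
  have "[m..<Suc r] = [m..<m + e] @ [m + e..<Suc r]"
    using upt_add_eq_append[of m "m + e" "sum_list es"] m(2) by simp
  then have "[m..<Suc r] = m # [Suc m..<m + e] @ [m + e..<Suc r]"
    using m(1) upt_conv_Cons[of m "m + e"] by simp
  moreover have "f m = Suc d" using Cons.prems(3)[of 0] by (simp add: m_def)
  moreover have "map f [Suc m..<m + e] = replicate (e - 1) 1"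
  proof (rule replicate_eqI)
    fix y assume "y \<in> set (map f [Suc m..<m + e])"
    then obtain i where i: "y = f i" "m < i" "i < m + e" by auto
    \<comment> \<open>\<open>Suc r - i\<close> lies strictly between the first two suffix sums (the
      second taken as 0 if absent), hence is none of them.\<close>
    then have "Suc r - i \<noteq> e + sum_list es" "sum_list es < Suc r - i" using m(2) by linarith+
    then have "Suc r - i \<notin> set (suffix_sums (e # es))" using notin by simp
    then have "f i = 1" using i m by (intro Cons.prems(4)) auto
    with i show "y = 1" by simp
  qed simp
  moreover have "map f [Suc r - sum_list es..<Suc r] = run_blocks ds es"
  proof (rule Cons.IH)
    show "f (Suc r - suffix_sums es ! j) = Suc (ds ! j)" if "j < length ds" for j
      using Cons.prems(3)[of "Suc j"] that by simp
    show "f i = 1" if "Suc r - sum_list es \<le> i" "i \<le> r" "Suc r - i \<notin> set (suffix_sums es)" for i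
      using that m by (intro Cons.prems(4)) auto
  qed (use Cons.prems in auto)
  moreover have "Suc r - sum_list es = m + e" using m(2) by simp
  moreover have "Suc r - sum_list (e # es) = m" by (simp add: m_def)
  ultimately show ?case by (simp del: upt_Suc)
qed simp

definition zcycle :: "nat \<Rightarrow> nat set \<Rightarrow> nat \<Rightarrow> nat list" where
  "zcycle r A i = rev [Suc (belt r A (i - 1))..<Suc (belt r A i)] @ [aelt r A i]"

section \<open>The blocks of \<open>zperm\<close> for the set with given runs\<close>

context
  fixes r n ds es A k
  assumes runs: "(ds, es) \<in> runs r n" and rn: "r \<le> n"
  defines "A \<equiv> set_of_runs r (ds, es)" and "k \<equiv> length ds"
begin

lemma runs_D: "length es = k" "\<forall>d\<in>set ds. 0 < d" "\<forall>e\<in>set es. 0 < e"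
  "sum_list ds \<le> n - r" "sum_list es \<le> r"
  using runs by (auto simp: runs_def k_def)

lemma card_initial_diff: "card ({1..r} - A) = k"
  using arg_cong[OF sorted_list_initial_diff_set_of_runs[OF runs], of length] runs_D(1)
  by (simp add: A_def del: One_nat_def)

text \<open>The missing elements increase with the run index but the a_i are numbered decreasingly,
  so a_i belongs to list position k - i.\<close>

lemma aelt_eq:
  assumes "1 \<le> i" "i \<le> k"
  shows "aelt r A i = Suc r - sum_list (drop (k - i) es)"
  using assms runs_D(1)
  by (simp add: aelt_def A_def sorted_list_initial_diff_set_of_runs[OF runs] rev_nth
      nth_suffix_sums del: One_nat_def)

text \<open>The same index reversal applies to the b_i; at i = 0 the suffix is empty, which
  reproduces the convention b_0 = r.\<close>

lemma belt_eq:
  assumes "i \<le> k"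
  shows "belt r A i = r + sum_list (drop (k - i) ds)"
  using assms
  by (cases i) (simp_all add: belt_def A_def sorted_list_set_of_runs_diff_initial[OF runs] rev_nth
      nth_suffix_sums k_def del: One_nat_def)

lemma zperm_eq: "zperm r A = foldr (\<circ>) (map cycle_of_list (map (zcycle r A) [1..<Suc k])) id"
  by (simp add: zperm_def card_initial_diff zcycle_def o_def del: One_nat_def upt_Suc)

lemma set_zcycle: "set (zcycle r A i) = insert (aelt r A i) {belt r A (i - 1)<..belt r A i}"
  by (auto simp: zcycle_def)

lemma belt_mono:
  assumes "i \<le> j" "j \<le> k"
  shows "belt r A i \<le> belt r A j"
proof (cases "i = j")
  case False
  then have "sum_list (drop (k - i) ds) < sum_list (drop (k - j) ds)"
    using assms by (intro sum_list_drop_strict_mono[OF runs_D(2)]) (auto simp: k_def)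
  with assms show ?thesis by (simp add: belt_eq)
qed simp

lemma sum_list_drop_es: "sum_list (drop j es) \<le> r"
  using runs_D(5) sum_list_append[of "take j es" "drop j es"] by simp

lemma aelt_bounds:
  assumes "1 \<le> i" "i \<le> k"
  shows "1 \<le> aelt r A i" "aelt r A i \<le> r"
proof -
  have "sum_list (drop k es) < sum_list (drop (k - i) es)"
    using assms by (intro sum_list_drop_strict_mono[OF runs_D(3)]) (auto simp: runs_D(1))
  with assms sum_list_drop_es[of "k - i"] show "1 \<le> aelt r A i" "aelt r A i \<le> r"
    by (simp_all add: aelt_eq)
qed

lemma aelt_strict_antimono:
  assumes "1 \<le> i" "i < j" "j \<le> k"
  shows "aelt r A j < aelt r A i"
proof -
  have "sum_list (drop (k - i) es) < sum_list (drop (k - j) es)"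
    using assms by (intro sum_list_drop_strict_mono[OF runs_D(3)]) (auto simp: runs_D(1))
  with assms sum_list_drop_es[of "k - j"] show ?thesis by (simp add: aelt_eq)
qed

text \<open>The a_i are distinct and at most r, while the intervals between consecutive b_i lie
  beyond r and do not overlap.\<close>

lemma set_zcycle_disjoint:
  assumes "1 \<le> i" "i < j" "j \<le> k"
  shows "set (zcycle r A i) \<inter> set (zcycle r A j) = {}"
proof -
  have "belt r A i \<le> belt r A (j - 1)" "belt r A 0 \<le> belt r A (i - 1)" "belt r A 0 = r"
    "belt r A 0 \<le> belt r A (j - 1)"
    using assms by (auto intro!: belt_mono) (simp add: belt_eq k_def)
  then show ?thesis
    using assms aelt_strict_antimono[OF assms] aelt_bounds[of i] aelt_bounds[of j]
    by (auto simp: set_zcycle)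
qed

lemma distinct_zcycle:
  assumes "1 \<le> i" "i \<le> k"
  shows "distinct (zcycle r A i)"
proof -
  have "belt r A 0 \<le> belt r A (i - 1)" "belt r A 0 = r"
    using assms by (auto intro: belt_mono simp: belt_eq k_def)
  with aelt_bounds[OF assms] show ?thesis by (auto simp: zcycle_def)
qed

lemma distinct_concat_zcycle: "distinct (concat (map (zcycle r A) [1..<Suc k]))"
proof (rule distinct_concat_map)
  fix i j assume "i \<in> set [1..<Suc k]" "j \<in> set [1..<Suc k]" "i \<noteq> j"
  then show "set (zcycle r A i) \<inter> set (zcycle r A j) = {}"
    using set_zcycle_disjoint[of i j] set_zcycle_disjoint[of j i] by (cases "i < j") auto
qed (auto simp: distinct_zcycle)

text \<open>Every other element of the \<open>i\<close>-th cycle lies beyond r, so a_i is its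
  minimum and the block is the support of this cycle.\<close>

lemma card_block_aelt:
  assumes "1 \<le> i" "i \<le> k"
  shows "card (block r n A (aelt r A i)) = Suc (belt r A i - belt r A (i - 1))"
proof -
  have b: "belt r A 0 \<le> belt r A (i - 1)" "belt r A 0 = r"
    using assms by (auto intro: belt_mono simp: belt_eq k_def)
  have orb: "orbit (zperm r A) (aelt r A i) = set (zcycle r A i)"
    unfolding zperm_eq using assms
    by (intro orbit_foldr_cycles[OF distinct_concat_zcycle])
      (simp_all add: set_zcycle del: upt_Suc)
  have "block r n A (aelt r A i) = orbit (zperm r A) (aelt r A i)"
  proof (rule block_eq_orbit)
    show "permutation (zperm r A)" unfolding zperm_eq by (rule permutation_foldr_cycles)
    show "aelt r A i \<in> {1..n}" using aelt_bounds[OF assms] rn by auto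
    show "Min (orbit (zperm r A) (aelt r A i)) = aelt r A i"
      unfolding orb using aelt_bounds[OF assms] b by (intro Min_eqI) (auto simp: set_zcycle)
  qed
  then show ?thesis
    using aelt_bounds[OF assms] b by (simp add: orb set_zcycle)
qed

text \<open>Inside [r] the cycles move only missing elements, so an element of A there is a fixed
  point.\<close>

lemma card_block_fixed:
  assumes "i \<in> {1..r} \<inter> A"
  shows "card (block r n A i) = 1"
proof -
  have "i \<notin> set (zcycle r A j)" if "1 \<le> j" "j \<le> k" for j
  proof -
    have "belt r A 0 \<le> belt r A (j - 1)" "belt r A 0 = r"
      using that by (auto intro: belt_mono simp: belt_eq k_def)
    moreover have "aelt r A j \<in> {1..r} - A"
    proof -
      have "aelt r A j \<in> set (rev (sorted_list_of_set ({1..r} - A)))"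
        unfolding aelt_def using that card_initial_diff by (intro nth_mem) auto
      then show ?thesis by simp
    qed
    ultimately show ?thesis using assms by (auto simp: set_zcycle)
  qed
  then have "i \<notin> set (concat (map (zcycle r A) [1..<Suc k]))" by auto
  then have "zperm r A i = i" unfolding zperm_eq by (rule foldr_cycles_outside)
  then have orb: "orbit (zperm r A) i = {i}" by (simp add: orbit_eq_singleton_iff)
  have "block r n A i = orbit (zperm r A) i"
  proof (rule block_eq_orbit)
    show "permutation (zperm r A)" unfolding zperm_eq by (rule permutation_foldr_cycles)
  qed (use assms rn orb in auto)
  with orb show ?thesis by simp
qed

text \<open>This reduces \<alpha>_A to the runs encoding: the block sizes with minima from a_k to r
  form \<open>run_blocks\<close>, and the definition of \<alpha>_A lowers the first of them by
  one.\<close>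

lemma comp_of_set_set_of_runs: "comp_of_set r n A = comp_of_runs (ds, es)"
proof (cases "ds = []")
  case True
  then have "A = {1..r}" "es = []" using runs_D(1) by (auto simp: A_def set_of_runs_def k_def)
  with True show ?thesis by (simp add: comp_of_set_def comp_of_runs_def)
next
  case False
  then have k: "1 \<le> k" by (simp add: k_def Suc_le_eq)
  with card_initial_diff have ne: "A \<noteq> {1..r}" by auto
  define f where "f = (\<lambda>i. card (block r n A i))"
  define m where "m = aelt r A k"
  have m: "m = Suc r - sum_list es" "m \<le> r"
    using aelt_eq[of k] aelt_bounds[of k] k by (simp_all add: m_def)
  have "comp_of_set r n A = (f m - 1) # map f [Suc m..<Suc r]"
    using ne by (simp only: comp_of_set_def card_initial_diff m_def f_def Let_def if_False)
  \<comment> \<open>The separately treated first entry is merged into the range, so that only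
    \<open>dec_hd\<close> remembers the subtraction.\<close>
  also have "\<dots> = dec_hd (map f [m..<Suc r])"
    using m(2) upt_conv_Cons[of m "Suc r"] by simp
  also have "map f [m..<Suc r] = run_blocks ds es"
    unfolding m(1)
  proof (rule map_eq_run_blocks)
    fix j assume j: "j < length ds"
    \<comment> \<open>The run at list position j belongs to a_i and b_i with i = k - j, and the
      preceding b has list position j + 1.\<close>
    then have j': "1 \<le> k - j" "k - j \<le> k" "k - (k - j) = j" "k - (k - j - 1) = Suc j"
      by (auto simp: k_def)
    have "f (aelt r A (k - j)) = Suc (sum_list (drop j ds) - sum_list (drop (Suc j) ds))"
      using card_block_aelt[OF j'(1,2)] belt_eq[of "k - j"] belt_eq[of "k - j - 1"] j'
      by (simp add: f_def)
    moreover have "sum_list (drop j ds) = ds ! j + sum_list (drop (Suc j) ds)"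
      using j by (simp add: Cons_nth_drop_Suc[symmetric])
    moreover have "aelt r A (k - j) = Suc r - suffix_sums es ! j"
      using aelt_eq[OF j'(1,2)] j j' runs_D(1) by (simp add: nth_suffix_sums k_def)
    ultimately show "f (Suc r - suffix_sums es ! j) = Suc (ds ! j)" by simp
  next
    fix i assume i: "Suc r - sum_list es \<le> i" "i \<le> r" "Suc r - i \<notin> set (suffix_sums es)"
    then have "1 \<le> i" using runs_D(5) by simp
    moreover have "i \<notin> (\<lambda>x. Suc r - x) ` set (suffix_sums es)"
      using i runs_suffix_sums(2)[OF runs] by (force dest: subsetD)
    ultimately have "i \<in> {1..r} \<inter> A"
      using initial_diff_set_of_runs[OF runs] i(2) by (auto simp: A_def set_of_runs_def)
    then show "f i = 1" unfolding f_def by (rule card_block_fixed)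
  qed (use runs_D in \<open>simp_all add: k_def\<close>)
  finally show ?thesis by (simp add: comp_of_runs_def)
qed

end

section \<open>The Frobenius symbol of the partition of a set\<close>

lemma sorted_list_of_set_split:
  fixes A :: "nat set"
  assumes "finite A"
  shows "sorted_list_of_set A = sorted_list_of_set {x\<in>A. x < c} @ sorted_list_of_set {x\<in>A. c \<le> x}"
  using assms by (intro strict_sorted_equal[symmetric]) (auto simp: sorted_wrt_append)

text \<open>The elements below \<open>c\<close> form an initial segment of the sorted list. This
  turns conditions on boxes into cardinalities.\<close>

lemma sorted_list_of_set_nth_less_iff:
  fixes A :: "nat set"
  assumes "finite A" "p < card A"
  shows "sorted_list_of_set A ! p < c \<longleftrightarrow> p < card {x\<in>A. x < c}"
proof -
  let ?B = "{x\<in>A. x < c}" and ?C = "{x\<in>A. c \<le> x}"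
  have fin: "finite ?B" "finite ?C" using assms by auto
  have split: "sorted_list_of_set A ! p = (sorted_list_of_set ?B @ sorted_list_of_set ?C) ! p"
    using sorted_list_of_set_split[OF assms(1)] by metis
  have len: "length (sorted_list_of_set ?B) + length (sorted_list_of_set ?C) = card A"
    using arg_cong[OF sorted_list_of_set_split[OF assms(1), of c], of length] by simp
  show ?thesis
  proof (cases "p < card ?B")
    case True
    then have "sorted_list_of_set A ! p \<in> set (sorted_list_of_set ?B)"
      using nth_mem[of p "sorted_list_of_set ?B"] by (simp add: split nth_append)
    with True fin show ?thesis by simp
  next
    case False
    then have "sorted_list_of_set A ! p \<in> set (sorted_list_of_set ?C)"
      unfolding split using len assms(2) by (subst nth_append_right) (auto intro!: nth_mem)
    with False fin show ?thesis by simp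
  qed
qed

lemma card_less_sorted_list_of_set_nth:
  fixes A :: "nat set"
  assumes "finite A" "p < card A"
  shows "card {x\<in>A. x < sorted_list_of_set A ! p} = p"
proof (rule antisym)
  show "card {x\<in>A. x < sorted_list_of_set A ! p} \<le> p"
    using sorted_list_of_set_nth_less_iff[OF assms, of "sorted_list_of_set A ! p"] by simp
  show "p \<le> card {x\<in>A. x < sorted_list_of_set A ! p}"
  proof (cases p)
    case (Suc q)
    have "sorted_list_of_set A ! q < sorted_list_of_set A ! p"
      using assms Suc by (intro sorted_wrt_nth_less[of "(<)"]) auto
    then show ?thesis
      using sorted_list_of_set_nth_less_iff[of A q "sorted_list_of_set A ! p"] assms Suc by simp
  qed simp
qed

text \<open>Each step in a strictly increasing list of naturals gains at least 1. This is why the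
  numbers i_j - j are weakly increasing in j.\<close>

lemma strict_sorted_nth_gap:
  fixes xs :: "nat list"
  assumes "sorted_wrt (<) xs" "p \<le> q" "q < length xs"
  shows "xs ! p + (q - p) \<le> xs ! q"
  using assms(2,3)
proof (induction q rule: dec_induct)
  case (step q)
  then have "xs ! q < xs ! Suc q" using assms(1) by (intro sorted_wrt_nth_less[of "(<)"]) auto
  with step show ?case by simp
qed simp

text \<open>The zeros of a weakly decreasing list form its tail, so dropping them loses nothing once
  the length is known.\<close>

lemma antimono_filter_pos:
  fixes xs :: "nat list"
  assumes "sorted_wrt (\<ge>) xs"
  shows "xs = filter (\<lambda>x. 0 < x) xs @ replicate (length xs - length (filter (\<lambda>x. 0 < x) xs)) 0"
  using assms
proof (induction xs)
  case (Cons x xs)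
  show ?case
  proof (cases "x = 0")
    case True
    with Cons.prems have "\<forall>y\<in>set (x # xs). y = 0" by auto
    then have "filter (\<lambda>x. 0 < x) (x # xs) = []" "x # xs = replicate (length (x # xs)) 0"
      by (auto simp: filter_empty_conv intro!: replicate_eqI)
    then show ?thesis by (metis append_Nil diff_zero list.size(3))
  next
    case False
    with Cons show ?thesis by simp
  qed
qed simp

text \<open>A zero row contributes no box, so the diagram can be read off the padded list without
  tracking the number of parts.\<close>

lemma diagram_filter_pos:
  assumes "sorted_wrt (\<ge>) xs"
  shows "(i, j) \<in> diagram (filter (\<lambda>x. 0 < x) xs) \<longleftrightarrow>
    1 \<le> i \<and> i \<le> length xs \<and> 1 \<le> j \<and> j \<le> xs ! (i - 1)"
proof -
  define ys where "ys = filter (\<lambda>x. 0 < x) xs"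
  define m where "m = length xs - length ys"
  have xs: "xs = ys @ replicate m 0"
    using antimono_filter_pos[OF assms] by (simp add: ys_def m_def)
  have "(i, j) \<in> diagram ys \<longleftrightarrow> 1 \<le> i \<and> i \<le> length xs \<and> 1 \<le> j \<and> j \<le> xs ! (i - 1)"
    unfolding diagram_def xs by (auto simp: nth_append)
  then show ?thesis by (simp add: ys_def)
qed

text \<open>The list behind \<open>part_of_set\<close> before zeros are dropped; its fixed length r
  makes index arithmetic possible.\<close>

definition shifted_parts :: "nat \<Rightarrow> nat set \<Rightarrow> nat list" where
  "shifted_parts r A = map (\<lambda>j. sorted_list_of_set A ! (j - 1) - j) (rev [1..<Suc r])"

lemma part_of_set_eq: "part_of_set r A = filter (\<lambda>x. 0 < x) (shifted_parts r A)"
  by (simp add: part_of_set_def shifted_parts_def)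

lemma length_shifted_parts [simp]: "length (shifted_parts r A) = r"
  by (simp add: shifted_parts_def)

lemma shifted_parts_nth:
  assumes "i < r"
  shows "shifted_parts r A ! i = sorted_list_of_set A ! (r - Suc i) - (r - i)"
  using assms by (simp add: shifted_parts_def rev_nth del: upt_Suc)

lemma rsubsets_D:
  assumes "A \<in> rsubsets r n"
  shows "finite A" "card A = r" "A \<subseteq> {1..n}"
  using assms by (auto simp: rsubsets_def intro: finite_subset)

text \<open>The \<open>p\<close>-th entry has p smaller elements and r - p - 1 larger ones within
  {1..n}. The lower bound makes the subtraction in \<open>shifted_parts\<close> exact; the upper one
  bounds the parts by n - r.\<close>

lemma sorted_list_rsubset_bounds:
  assumes "A \<in> rsubsets r n" "p < r"
  shows "Suc p \<le> sorted_list_of_set A ! p" "sorted_list_of_set A ! p + (r - Suc p) \<le> n"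
proof -
  let ?s = "sorted_list_of_set A"
  note A = rsubsets_D[OF assms(1)]
  have in_A: "?s ! q \<in> A" if "q < r" for q
    using that A nth_mem[of q ?s] by simp
  have "?s ! 0 + (p - 0) \<le> ?s ! p"
    using A assms(2) by (intro strict_sorted_nth_gap) auto
  moreover have "1 \<le> ?s ! 0" using in_A[of 0] A assms(2) by auto
  ultimately show "Suc p \<le> ?s ! p" by simp
  have "?s ! p + (r - 1 - p) \<le> ?s ! (r - 1)"
    using A assms(2) by (intro strict_sorted_nth_gap) auto
  moreover have "?s ! (r - 1) \<le> n" using in_A[of "r - 1"] A assms(2) by auto
  ultimately show "?s ! p + (r - Suc p) \<le> n" by simp
qed

lemma sorted_shifted_parts:
  assumes "A \<in> rsubsets r n"
  shows "sorted_wrt (\<ge>) (shifted_parts r A)"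
  unfolding sorted_wrt_iff_nth_less
proof (intro allI impI)
  fix i j assume ij: "i < j" "j < length (shifted_parts r A)"
  have "sorted_list_of_set A ! (r - Suc j) + ((r - Suc i) - (r - Suc j)) \<le> sorted_list_of_set A ! (r - Suc i)"
    using ij rsubsets_D[OF assms] by (intro strict_sorted_nth_gap) auto
  with ij show "shifted_parts r A ! j \<le> shifted_parts r A ! i"
    by (simp add: shifted_parts_nth)
qed

lemma bij_betw_part_of_set:
  assumes "r \<le> n"
  shows "bij_betw (part_of_set r) (rsubsets r n) (Part r n)"
  unfolding bij_betw_def
proof
  show "inj_on (part_of_set r) (rsubsets r n)"
  proof (rule inj_onI)
    fix A B
    assume A: "A \<in> rsubsets r n" and B: "B \<in> rsubsets r n" and eq: "part_of_set r A = part_of_set r B"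
    \<comment> \<open>Both padded lists have length r, so equal positive parts force equally many
      trailing zeros.\<close>
    have "shifted_parts r A = shifted_parts r B"
      using antimono_filter_pos[OF sorted_shifted_parts[OF A]]
        antimono_filter_pos[OF sorted_shifted_parts[OF B]] eq
      by (metis part_of_set_eq length_shifted_parts)
    have "sorted_list_of_set A ! p = sorted_list_of_set B ! p" if "p < r" for p
    proof -
      have "sorted_list_of_set A ! p - Suc p = sorted_list_of_set B ! p - Suc p"
        using that shifted_parts_nth[of "r - Suc p" r A] shifted_parts_nth[of "r - Suc p" r B]
          \<open>shifted_parts r A = shifted_parts r B\<close> by (simp add: Suc_diff_Suc)
      with sorted_list_rsubset_bounds(1)[OF A that] sorted_list_rsubset_bounds(1)[OF B that]
      show ?thesis by simp
    qed
    then have "sorted_list_of_set A = sorted_list_of_set B"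
      using rsubsets_D[OF A] rsubsets_D[OF B] by (intro nth_equalityI) auto
    then show "A = B"
      using rsubsets_D[OF A] rsubsets_D[OF B] by (metis sorted_list_of_set.set_sorted_key_list_of_set)
  qed
  have "part_of_set r A \<in> Part r n" if A: "A \<in> rsubsets r n" for A
  proof -
    have "x \<le> n - r" if x: "x \<in> set (shifted_parts r A)" for x
    proof -
      obtain i where i: "i < r" "x = shifted_parts r A ! i" using x by (auto simp: in_set_conv_nth)
      then show ?thesis
        using sorted_list_rsubset_bounds(2)[OF A, of "r - Suc i"] by (simp add: shifted_parts_nth)
    qed
    moreover have "length (part_of_set r A) \<le> r"
      unfolding part_of_set_eq using length_filter_le[of _ "shifted_parts r A"] by simp
    ultimately show ?thesis
      using sorted_shifted_parts[OF A]
      by (auto simp: Part_def part_of_set_eq intro: sorted_wrt_filter)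
  qed
  moreover have "lam \<in> part_of_set r ` rsubsets r n" if "lam \<in> Part r n" for lam
  proof -
    have lam: "sorted_wrt (\<ge>) lam" "\<forall>x\<in>set lam. 1 \<le> x \<and> x \<le> n - r" "length lam \<le> r"
      using that by (auto simp: Part_def)
    have zeros: "sorted_wrt (\<ge>) (replicate m (0::nat))" for m
      by (induction m) auto
    define xs where "xs = lam @ replicate (r - length lam) 0"
    have xs: "length xs = r" "sorted_wrt (\<ge>) xs" "\<forall>x\<in>set xs. x \<le> n - r"
      "filter (\<lambda>x. 0 < x) xs = lam"
      using lam zeros by (auto simp: xs_def sorted_wrt_append filter_id_conv Suc_le_eq)
    \<comment> \<open>Adding the position p + 1 back to the padded parts, read from the smallest up,
      inverts \<open>shifted_parts\<close>.\<close>
    define s where "s = map (\<lambda>p. xs ! (r - Suc p) + Suc p) [0..<r]"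
    have s_nth: "s ! p = xs ! (r - Suc p) + Suc p" if "p < r" for p
      using that by (simp add: s_def)
    have "sorted_wrt (<) s"
      unfolding sorted_wrt_iff_nth_less
    proof (intro allI impI)
      fix p q assume "p < q" "q < length s"
      then have "xs ! (r - Suc p) \<le> xs ! (r - Suc q)"
        using xs(1) by (intro sorted_wrt_nth_less[OF xs(2)]) (auto simp: s_def)
      with \<open>p < q\<close> \<open>q < length s\<close> show "s ! p < s ! q" by (simp add: s_def)
    qed
    then have sorted: "sorted_list_of_set (set s) = s" by (intro strict_sorted_equal) auto
    have "set s \<subseteq> {1..n}"
    proof
      fix x assume "x \<in> set s"
      then obtain p where p: "p < r" "x = xs ! (r - Suc p) + Suc p" by (auto simp: s_def)
      then have "xs ! (r - Suc p) \<le> n - r" using xs by auto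
      with p assms show "x \<in> {1..n}" by auto
    qed
    moreover have "card (set s) = r"
      using \<open>sorted_wrt (<) s\<close> distinct_card[of s] strict_sorted_iff[of s] by (simp add: s_def)
    ultimately have "set s \<in> rsubsets r n" by (simp add: rsubsets_def)
    moreover have "shifted_parts r (set s) = xs"
      using xs(1) s_nth by (intro nth_equalityI) (simp_all add: shifted_parts_nth sorted)
    then have "part_of_set r (set s) = lam" by (simp add: part_of_set_eq xs)
    ultimately show ?thesis by blast
  qed
  ultimately show "part_of_set r ` rsubsets r n = Part r n" by blast
qed

text \<open>Row i has i_{r+1-i} - (r+1-i) boxes, so it meets the diagonal exactly when this element
  of A exceeds r, and its arm is the excess over r + 1. The leg follows by counting the elements of
  A below the \<open>i\<close>-th missing element.\<close>

lemma frobenius_part_of_set: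
  assumes A: "A \<in> rsubsets r n"
  shows "frobenius (part_of_set r A) =
    (map (\<lambda>b. b - Suc r) (rev (sorted_list_of_set (A - {1..r}))),
     map (\<lambda>c. r - c) (sorted_list_of_set ({1..r} - A)))"
proof -
  note fin = rsubsets_D(1)[OF A] and card = rsubsets_D(2)[OF A] and sub = rsubsets_D(3)[OF A]
  let ?s = "sorted_list_of_set A"
  define lam where "lam = part_of_set r A"
  define k where "k = card (A - {1..r})"
  define bs where "bs = sorted_list_of_set (A - {1..r})"
  define cs where "cs = sorted_list_of_set ({1..r} - A)"
  have lens: "length bs = k" "length cs = k"
    using card_diff_sym[of A "{1..r}"] fin card by (simp_all add: bs_def cs_def k_def)
  have split: "{x\<in>A. x < Suc r} = A \<inter> {1..r}" "{x\<in>A. Suc r \<le> x} = A - {1..r}"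
    using sub by auto
  have card_Int: "card (A \<inter> {1..r}) + k = r"
    using card_Int_Diff[OF fin, of "{1..r}"] card by (simp add: k_def)
  have s: "?s = sorted_list_of_set (A \<inter> {1..r}) @ bs"
    using sorted_list_of_set_split[OF fin, of "Suc r"] by (simp only: split bs_def)
  \<comment> \<open>The elements beyond r are the k largest ones, so the same entry is addressed
    from the end of \<open>bs\<close>.\<close>
  have s_nth: "?s ! (r - i) = bs ! (k - i)" if "1 \<le> i" "i \<le> k" for i
  proof -
    have "r - i - card (A \<inter> {1..r}) = k - i" "\<not> r - i < card (A \<inter> {1..r})"
      using that card_Int by linarith+
    then show ?thesis by (simp add: s nth_append)
  qed
  have diag: "(i, j) \<in> diagram lam \<longleftrightarrow> 1 \<le> i \<and> i \<le> r \<and> 1 \<le> j \<and> j + (Suc r - i) \<le> ?s ! (r - i)" for i j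
    using diagram_filter_pos[OF sorted_shifted_parts[OF A], of i j]
    by (auto simp: lam_def part_of_set_eq shifted_parts_nth Suc_diff_le)
  have "(i, i) \<in> diagram lam \<longleftrightarrow> 1 \<le> i \<and> i \<le> k" for i
  proof (cases "1 \<le> i \<and> i \<le> r")
    case True
    then have "?s ! (r - i) < Suc r \<longleftrightarrow> r - i < card (A \<inter> {1..r})"
      using sorted_list_of_set_nth_less_iff[OF fin, of "r - i" "Suc r"] card by (simp only: split) auto
    with True card_Int show ?thesis by (auto simp: diag)
  next
    case False
    with card_Int show ?thesis by (auto simp: diag)
  qed
  then have D: "{i. (i, i) \<in> diagram lam} = {1..<Suc k}"
    by (simp add: set_eq_iff less_Suc_eq_le)
  have arm: "arm lam (i, i) = bs ! (k - i) - Suc r" if i: "1 \<le> i" "i \<le> k" for i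
  proof -
    have "bs ! (k - i) \<in> A - {1..r}"
      using nth_mem[of "k - i" bs] i lens fin by (simp add: bs_def)
    then have "Suc r \<le> bs ! (k - i)" using sub by auto
    then have "{j'. i < j' \<and> (i, j') \<in> diagram lam} = {i<..bs ! (k - i) - (Suc r - i)}"
      using i card_Int by (auto simp: diag s_nth)
    with i card_Int show ?thesis by (simp add: arm_def)
  qed
  have leg: "leg lam (i, i) = r - cs ! (i - 1)" if i: "1 \<le> i" "i \<le> k" for i
  proof -
    define c where "c = cs ! (i - 1)"
    have c: "c \<in> {1..r} - A"
      using nth_mem[of "i - 1" cs] i lens by (simp add: cs_def c_def)
    \<comment> \<open>The i - 1 missing elements and the elements of A below c together fill
      {1..<c}. This also yields i at most c, so c - i is an exact difference.\<close>
    have "card {x \<in> {1..r} - A. x < c} = i - 1"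
      unfolding c_def cs_def using i lens
      by (intro card_less_sorted_list_of_set_nth) (auto simp: cs_def)
    moreover have "{x \<in> {1..r} - A. x < c} \<union> {x\<in>A. x < c} = {1..<c}"
      using c sub by auto
    moreover have "card ({x \<in> {1..r} - A. x < c} \<union> {x\<in>A. x < c}) =
        card {x \<in> {1..r} - A. x < c} + card {x\<in>A. x < c}"
      using fin by (intro card_Un_disjoint) auto
    ultimately have card_c: "i - 1 + card {x\<in>A. x < c} = c - 1" by simp
    have "i \<le> c" using card_c c i by auto
    \<comment> \<open>Exactly \<open>c - i\<close> elements of \<open>A\<close> lie below the \<open>i\<close>-th missing element \<open>c\<close>, so they are the rows
        of the diagram that do not reach column \<open>i\<close>.\<close>
    have row: "i + Suc p \<le> ?s ! p \<longleftrightarrow> c - i \<le> p" if p: "p < r" for p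
    proof (cases "c - i \<le> p")
      case True
      \<comment> \<open>Position c - i holds the first element of A that is not below c; it differs
        from c, which is missing, and the gap estimate carries the bound on to p.\<close>
      have "\<not> ?s ! (c - i) < c"
        using sorted_list_of_set_nth_less_iff[OF fin, of "c - i" c] card card_c True p i by auto
      moreover have "?s ! (c - i) \<in> A"
        using nth_mem[of "c - i" ?s] fin card True p by simp
      ultimately have "c < ?s ! (c - i)" using c by (metis DiffD2 nat_neq_iff)
      moreover have "?s ! (c - i) + (p - (c - i)) \<le> ?s ! p"
        using fin card True p by (intro strict_sorted_nth_gap) auto
      ultimately show ?thesis using True \<open>i \<le> c\<close> by linarith
    next
      case False
      have "?s ! (c - i - 1) < c"
        using sorted_list_of_set_nth_less_iff[OF fin, of "c - i - 1" c] card card_c False c i by auto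
      moreover have "?s ! p + (c - i - 1 - p) \<le> ?s ! (c - i - 1)"
        using fin card False c i by (intro strict_sorted_nth_gap) auto
      moreover have "(c - i - 1 - p) + (i + Suc p) = c" using False by simp
      ultimately have "?s ! p < i + Suc p" by linarith
      with False show ?thesis by simp
    qed
    \<comment> \<open>Row i' sits at sorted position r - i', so \<open>row\<close> bounds i' by r +
      i - c, leaving r - c rows below row i.\<close>
    have "{i'. i < i' \<and> (i', i) \<in> diagram lam} = {i<..r + i - c}"
    proof (intro set_eqI)
      fix i'
      show "i' \<in> {i'. i < i' \<and> (i', i) \<in> diagram lam} \<longleftrightarrow> i' \<in> {i<..r + i - c}"
      proof (cases "i < i' \<and> i' \<le> r")
        case True
        with row[of "r - i'"] i \<open>i \<le> c\<close> c show ?thesis by (auto simp: diag Suc_diff_le)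
      next
        case False
        with \<open>i \<le> c\<close> show ?thesis by (auto simp: diag)
      qed
    qed
    then show ?thesis using \<open>i \<le> c\<close> by (simp add: leg_def c_def)
  qed
  have "frobenius lam = (map (\<lambda>i. arm lam (i, i)) [1..<Suc k], map (\<lambda>i. leg lam (i, i)) [1..<Suc k])"
    by (simp only: frobenius_def D sorted_list_of_set_range Let_def)
  moreover have "map (\<lambda>i. arm lam (i, i)) [1..<Suc k] = map (\<lambda>b. b - Suc r) (rev bs)"
    using lens by (intro nth_equalityI) (auto simp: arm rev_nth simp del: upt_Suc)
  moreover have "map (\<lambda>i. leg lam (i, i)) [1..<Suc k] = map (\<lambda>c. r - c) cs"
    using lens by (intro nth_equalityI) (auto simp: leg simp del: upt_Suc)
  ultimately show ?thesis by (simp add: lam_def bs_def cs_def)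
qed

text \<open>The first diagonal box is (1,1), whose arm and leg span the first row and the first
  column; this connects the symbol with \<open>OHL\<close>.\<close>

lemma hd_frobenius:
  assumes "lam \<noteq> []" "\<forall>x\<in>set lam. 0 < x"
  shows "hd (fst (frobenius lam)) = hd lam - 1" "hd (snd (frobenius lam)) = length lam - 1"
proof -
  let ?D = "{i. (i, i) \<in> diagram lam}"
  have nth: "0 < lam ! i" if "i < length lam" for i using assms(2) that by simp
  have "?D \<subseteq> {1..length lam}" by (auto simp: diagram_def)
  then have fin: "finite ?D" using finite_subset by blast
  have one: "1 \<in> ?D" using assms(1) nth[of 0] by (simp add: diagram_def Suc_le_eq)
  have "Min ?D = 1" using fin one by (intro Min_eqI) (auto simp: diagram_def)
  then obtain D' where D: "sorted_list_of_set ?D = 1 # D'"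
    using sorted_list_of_set_nonempty[OF fin] one by auto
  have "{j'. 1 < j' \<and> (1, j') \<in> diagram lam} = {1<..hd lam}"
    using assms(1) by (auto simp: diagram_def hd_conv_nth Suc_le_eq)
  then show "hd (fst (frobenius lam)) = hd lam - 1"
    by (simp add: frobenius_def D arm_def del: One_nat_def)
  have "{i'. 1 < i' \<and> (i', 1) \<in> diagram lam} = {1<..length lam}"
    using assms(1) nth by (auto simp: diagram_def Suc_le_eq)
  then show "hd (snd (frobenius lam)) = length lam - 1"
    by (simp add: frobenius_def D leg_def del: One_nat_def)
qed

section \<open>The correspondence\<close>

text \<open>Precomposed with the bijection \<open>set_of_runs\<close>, the map becomes the bijection
  \<open>comp_of_runs\<close>, hence it is bijective itself.\<close>

lemma bij_betw_comp_of_set: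
  assumes "r \<le> n"
  shows "bij_betw (comp_of_set r n) (rsubsets r n) (Comp r n)"
proof -
  have "bij_betw (comp_of_set r n \<circ> set_of_runs r) (runs r n) (Comp r n)"
    using comp_of_set_set_of_runs[OF _ assms] bij_betw_comp_of_runs[of r n]
    by (subst bij_betw_cong[of _ _ comp_of_runs]) auto
  then show ?thesis
    using bij_betw_comp_iff[OF bij_betw_set_of_runs[OF assms]] by blast
qed

lemma bij_betw_comp_to_part:
  assumes "r \<le> n"
  shows "bij_betw (comp_to_part r n) (Comp r n) (Part r n)"
proof -
  have "bij_betw (part_of_set r \<circ> the_inv_into (rsubsets r n) (comp_of_set r n)) (Comp r n) (Part r n)"
    using bij_betw_the_inv_into[OF bij_betw_comp_of_set[OF assms]] bij_betw_part_of_set[OF assms]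
    by (rule bij_betw_trans)
  then show ?thesis by (simp add: comp_to_part_def o_def cong: bij_betw_cong)
qed

text \<open>Eliminates the inverse hidden in \<open>comp_to_part\<close>: the runs of a composition
  name its set A explicitly.\<close>

lemma comp_to_part_comp_of_runs:
  assumes "(ds, es) \<in> runs r n" "r \<le> n"
  shows "comp_to_part r n (comp_of_runs (ds, es)) = part_of_set r (set_of_runs r (ds, es))"
proof -
  have "the_inv_into (rsubsets r n) (comp_of_set r n) (comp_of_runs (ds, es)) = set_of_runs r (ds, es)"
    unfolding comp_of_set_set_of_runs[OF assms, symmetric]
    using bij_betw_comp_of_set[OF assms(2)] set_of_runs_mem_rsubsets[OF assms]
    by (intro the_inv_into_f_f) (auto simp: bij_betw_def)
  then show ?thesis by (simp add: comp_to_part_def)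
qed

text \<open>Both explicit descriptions rest on this: (r + D_j) - (r + 1) = D_j - 1 and r - (r + 1 -
  E_j) = E_j - 1.\<close>

lemma frobenius_comp_to_part:
  assumes "(ds, es) \<in> runs r n" "r \<le> n"
  shows "frobenius (comp_to_part r n (comp_of_runs (ds, es))) =
    (map (\<lambda>x. x - 1) (suffix_sums ds), map (\<lambda>x. x - 1) (suffix_sums es))"
  using runs_suffix_sums(2)[OF assms(1)]
  by (auto simp: comp_to_part_comp_of_runs[OF assms] rev_map
      frobenius_part_of_set[OF set_of_runs_mem_rsubsets[OF assms]]
      sorted_list_initial_diff_set_of_runs[OF assms(1)]
      sorted_list_set_of_runs_diff_initial[OF assms(1)] simp del: One_nat_def)

lemma Comp_obtain_runs:
  assumes "\<alpha> \<in> Comp r n"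
  obtains ds es where "(ds, es) \<in> runs r n" "\<alpha> = comp_of_runs (ds, es)"
  using assms bij_betw_comp_of_runs[of r n] that unfolding bij_betw_def by force

lemma comp_of_runs_eq_Nil_iff:
  assumes "(ds, es) \<in> runs r n"
  shows "comp_of_runs (ds, es) = [] \<longleftrightarrow> ds = []"
  using assms by (cases ds; cases es) (auto simp: comp_of_runs_def runs_def)

text \<open>In the nonempty case both sides equal D_1 + E_1 - 1, since the first column of the
  symbol shows that \<lambda> has largest part D_1 and E_1 parts.\<close>

lemma sum_list_eq_OHL:
  assumes "\<alpha> \<in> Comp r n" "r \<le> n"
  shows "sum_list \<alpha> = OHL (comp_to_part r n \<alpha>)"
proof -
  obtain ds es where runs: "(ds, es) \<in> runs r n" and \<alpha>: "\<alpha> = comp_of_runs (ds, es)"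
    using assms(1) by (rule Comp_obtain_runs)
  define lam where "lam = comp_to_part r n \<alpha>"
  have frob: "frobenius lam = (map (\<lambda>x. x - 1) (suffix_sums ds), map (\<lambda>x. x - 1) (suffix_sums es))"
    using frobenius_comp_to_part[OF runs assms(2)] by (simp add: lam_def \<alpha>)
  have "lam \<in> Part r n"
    using bij_betw_comp_to_part[OF assms(2)] assms(1) by (auto simp: lam_def bij_betw_def)
  then have pos: "\<forall>x\<in>set lam. 0 < x" by (auto simp: Part_def Suc_le_eq)
  show ?thesis
  proof (cases "ds = []")
    case True
    then have "es = []" using runs by (simp add: runs_def)
    \<comment> \<open>A nonempty partition contains the box (1,1), so its symbol would have a
      column.\<close>
    have "lam = []"
    proof (rule ccontr)
      assume "lam \<noteq> []"
      then have "1 \<in> {i. (i, i) \<in> diagram lam}" using pos by (cases lam) (auto simp: diagram_def)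
      moreover have "{i. (i, i) \<in> diagram lam} \<subseteq> {1..length lam}" by (auto simp: diagram_def)
      then have "finite {i. (i, i) \<in> diagram lam}" using finite_subset by blast
      ultimately have "fst (frobenius lam) \<noteq> []"
        by (auto simp: frobenius_def Let_def sorted_list_of_set_eq_Nil_iff)
      with frob True show False by simp
    qed
    with True \<open>es = []\<close> show ?thesis
      unfolding lam_def[symmetric] by (simp add: OHL_def \<alpha> comp_of_runs_def)
  next
    case False
    then obtain d ds' e es' where de: "ds = d # ds'" "es = e # es'"
      using runs by (cases ds; cases es) (auto simp: runs_def)
    have "0 < d" "0 < e" using runs by (auto simp: de runs_def)
    have "lam \<noteq> []"
    proof
      assume "lam = []"
      then have "{i. (i, i) \<in> diagram lam} = {}" by (auto simp: diagram_def)
      then have "frobenius lam = ([], [])" by (simp add: frobenius_def)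
      with frob de show False by simp
    qed
    then have "hd lam - 1 = sum_list ds - 1" "length lam - 1 = sum_list es - 1"
      using hd_frobenius[OF _ pos] by (simp_all add: frob de)
    \<comment> \<open>Positivity allows cancelling the truncated subtractions of 1.\<close>
    moreover have "0 < hd lam" "0 < length lam" using pos \<open>lam \<noteq> []\<close> by auto
    moreover have "0 < sum_list ds" "0 < sum_list es"
      using \<open>0 < d\<close> \<open>0 < e\<close> by (simp_all add: de)
    ultimately have "hd lam = sum_list ds" "length lam = sum_list es" by linarith+
    then show ?thesis
      using sum_list_comp_of_runs[OF runs] \<open>lam \<noteq> []\<close>
      unfolding lam_def[symmetric] by (simp add: OHL_def \<alpha>)
  qed
qed

section \<open>From run lists to indexed decompositions and the inverse formula\<close>

lemma run_blocks_map:
  "run_blocks (map d xs) (map e xs) = concat (map (\<lambda>i. Suc (d i) # replicate (e i - 1) 1) xs)"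
  by (induction xs) auto

lemma decomposition_eq_comp_of_runs:
  assumes "1 \<le> k"
  shows "d 1 # replicate (e 1 - 1) 1 @ concat (map (\<lambda>i. (d i + 1) # replicate (e i - 1) 1) [2..<Suc k]) =
    comp_of_runs (map d [1..<Suc k], map e [1..<Suc k])"
proof -
  have "[1..<Suc k] = 1 # [2..<Suc k]"
    using assms upt_conv_Cons[of 1 "Suc k"] by (simp add: numeral_2_eq_2)
  then show ?thesis
    by (simp add: comp_of_runs_def run_blocks_map del: upt_Suc)
qed

text \<open>A decomposition mentions neither r nor n; its bounds are inherited from the run lists of
  \<alpha> by uniqueness.\<close>

lemma decomposition_runs:
  assumes dec: "is_decomposition \<alpha> k d e" and "\<alpha> \<in> Comp r n"
  shows "(map d [1..<Suc k], map e [1..<Suc k]) \<in> runs r n"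
    "\<alpha> = comp_of_runs (map d [1..<Suc k], map e [1..<Suc k])"
proof -
  let ?ds = "map d [1..<Suc k]" and ?es = "map e [1..<Suc k]"
  show \<alpha>: "\<alpha> = comp_of_runs (?ds, ?es)"
    using dec decomposition_eq_comp_of_runs unfolding is_decomposition_def by blast
  obtain ds es where runs: "(ds, es) \<in> runs r n" and "\<alpha> = comp_of_runs (ds, es)"
    using assms(2) by (rule Comp_obtain_runs)
  \<comment> \<open>Bounds large enough for both pairs of lists, so that injectivity identifies them.\<close>
  define r' where "r' = r + sum_list ?es"
  define n' where "n' = r' + n + sum_list ?ds"
  have "(ds, es) \<in> runs r' n'" using runs by (auto simp: runs_def r'_def n'_def)
  moreover have "(?ds, ?es) \<in> runs r' n'"
    using dec by (auto simp: is_decomposition_def runs_def r'_def n'_def Suc_le_eq simp del: upt_Suc)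
  ultimately have "(ds, es) = (?ds, ?es)"
    using inj_onD[OF inj_on_comp_of_runs] \<alpha> \<open>\<alpha> = comp_of_runs (ds, es)\<close> by metis
  with runs show "(?ds, ?es) \<in> runs r n" by simp
qed

lemma suffix_sums_map_upt:
  "suffix_sums (map f [1..<Suc k]) = map (\<lambda>j. \<Sum>i=j..k. f i) [1..<Suc k]"
proof (rule nth_equalityI)
  fix i assume "i < length (suffix_sums (map f [1..<Suc k]))"
  then have i: "i < k" by (simp del: upt_Suc)
  have "suffix_sums (map f [1..<Suc k]) ! i = sum_list (map f [Suc i..<Suc k])"
    using i by (simp add: nth_suffix_sums drop_map del: upt_Suc)
  also have "\<dots> = sum f {Suc i..k}"
    by (simp only: interv_sum_list_conv_sum_set_nat set_upt atLeastLessThanSuc_atLeastAtMost)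
  finally show "suffix_sums (map f [1..<Suc k]) ! i = map (\<lambda>j. \<Sum>i=j..k. f i) [1..<Suc k] ! i"
    using i by (simp del: upt_Suc)
qed simp

lemma map_nth_pred: "map (\<lambda>i. xs ! (i - 1)) [1..<Suc (length xs)] = xs"
  by (intro nth_equalityI) (auto simp del: upt_Suc)

lemma decomposition_exists:
  assumes "\<alpha> \<in> Comp r n" "\<alpha> \<noteq> []"
  shows "\<exists>k d e. is_decomposition \<alpha> k d e"
proof -
  obtain ds es where runs: "(ds, es) \<in> runs r n" and \<alpha>: "\<alpha> = comp_of_runs (ds, es)"
    using assms(1) by (rule Comp_obtain_runs)
  have len: "length es = length ds" using runs by (simp add: runs_def)
  have k: "1 \<le> length ds"
    using comp_of_runs_eq_Nil_iff[OF runs] assms(2) \<alpha> by (simp add: Suc_le_eq)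
  have "is_decomposition \<alpha> (length ds) (\<lambda>i. ds ! (i - 1)) (\<lambda>i. es ! (i - 1))"
    unfolding is_decomposition_def
  proof (intro conjI)
    show "\<forall>i\<in>{1..length ds}. 1 \<le> ds ! (i - 1) \<and> 1 \<le> es ! (i - 1)"
    proof
      fix i assume "i \<in> {1..length ds}"
      then have "ds ! (i - 1) \<in> set ds" "es ! (i - 1) \<in> set es" using len by auto
      with runs show "1 \<le> ds ! (i - 1) \<and> 1 \<le> es ! (i - 1)" by (simp add: runs_def Suc_le_eq)
    qed
    show "\<alpha> = ds ! (1 - 1) # replicate (es ! (1 - 1) - 1) 1 @
        concat (map (\<lambda>i. (ds ! (i - 1) + 1) # replicate (es ! (i - 1) - 1) 1) [2..<Suc (length ds)])"
      using decomposition_eq_comp_of_runs[OF k, of "\<lambda>i. ds ! (i - 1)" "\<lambda>i. es ! (i - 1)"]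
        map_nth_pred[of ds] map_nth_pred[of es] by (simp only: \<alpha> len)
  qed (rule k)
  then show ?thesis by blast
qed

text \<open>The head gives d_1 = 1, so it joins the e_1 - 1 ones after it. What follows is empty or
  starts with an entry of at least 2, so this run of ones is maximal.\<close>

lemma decomposition_initial_ones:
  assumes dec: "is_decomposition \<alpha> k d e"
    and a: "1 \<le> a" "\<alpha> = replicate a 1 @ \<beta>" "\<beta> = [] \<or> hd \<beta> \<noteq> 1"
  shows "d 1 = 1 \<and> e 1 = a"
proof -
  let ?rest = "run_blocks (map d [2..<Suc k]) (map e [2..<Suc k])"
  have \<alpha>: "\<alpha> = d 1 # replicate (e 1 - 1) 1 @ ?rest"
    using dec unfolding is_decomposition_def run_blocks_map by simp
  have "hd \<alpha> = 1" using a by (cases a) auto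
  with \<alpha> have d: "d 1 = 1" by simp
  have "1 \<le> e 1" using dec by (auto simp: is_decomposition_def)
  then have rep: "replicate (e 1) (1::nat) = 1 # replicate (e 1 - 1) 1" by (cases "e 1") auto
  have "replicate (e 1) 1 @ ?rest = replicate a 1 @ \<beta>"
    using \<alpha> a(2) d rep by (simp del: upt_Suc)
  moreover have "?rest = [] \<or> hd ?rest \<noteq> 1"
    using dec by (intro hd_run_blocks_ne_1) (auto simp: is_decomposition_def Suc_le_eq simp del: upt_Suc)
  ultimately have "e 1 = a \<and> ?rest = \<beta>" using a(3) by (rule replicate_append_inject)
  with d show ?thesis by simp
qed

text \<open>The d_i and e_i are consecutive differences of the rows, under the convention that both
  rows continue with -1 after column k. This explains the exceptional last entry A_k + 2 = d_k +
  1.\<close>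

lemma comp_of_frobenius_eq_decomposition:
  assumes "1 \<le> k"
    "\<And>i. 1 \<le> i \<Longrightarrow> i < k \<Longrightarrow> A i = d i + A (i + 1)"
    "\<And>i. 1 \<le> i \<Longrightarrow> i < k \<Longrightarrow> L i = e i + L (i + 1)"
    "d k = A k + 1" "e k = L k + 1"
  shows "comp_of_frobenius k A L = d 1 # replicate (e 1 - 1) 1 @
    concat (map (\<lambda>i. (d i + 1) # replicate (e i - 1) 1) [2..<Suc k])"
proof (cases "k = 1")
  case True
  with assms(4,5) show ?thesis by (simp add: comp_of_frobenius_def)
next
  case False
  with assms(1) have k: "2 \<le> k" by simp
  have inner: "map (\<lambda>i. (A i - A (i + 1) + 1) # replicate (L i - L (i + 1) - 1) 1) [2..<k] =
      map (\<lambda>i. (d i + 1) # replicate (e i - 1) 1) [2..<k]"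
    using assms(2,3) by (intro map_cong) auto
  have "A 1 - A 2 = d 1" "L 1 - L 2 = e 1"
    using assms(2)[of 1] assms(3)[of 1] k by (simp_all add: numeral_2_eq_2)
  moreover have upt: "[2..<Suc k] = [2..<k] @ [k]" using k by simp
  ultimately show ?thesis
    using False assms(4,5) unfolding comp_of_frobenius_def inner upt by simp
qed

lemma comp_of_frobenius_suffix_sums:
  assumes "(ds, es) \<in> runs r n" "ds \<noteq> []"
  shows "comp_of_frobenius (length ds)
      (\<lambda>i. map (\<lambda>x. x - 1) (suffix_sums ds) ! (i - 1)) (\<lambda>i. map (\<lambda>x. x - 1) (suffix_sums es) ! (i - 1)) =
    comp_of_runs (ds, es)"
proof -
  have len: "length es = length ds" using assms(1) by (simp add: runs_def)
  have k: "1 \<le> length ds" using assms(2) by (simp add: Suc_le_eq)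
  have step: "map (\<lambda>x. x - 1) (suffix_sums xs) ! (i - 1) =
      xs ! (i - 1) + map (\<lambda>x. x - 1) (suffix_sums xs) ! (i + 1 - 1)"
    if "\<forall>x\<in>set xs. 0 < x" "1 \<le> i" "i < length xs" for i and xs :: "nat list"
  proof -
    \<comment> \<open>The next suffix sum must be positive for the subtraction of 1 to commute with
      adding the entry.\<close>
    have "0 < suffix_sums xs ! i"
      using set_suffix_sums[OF that(1)] nth_mem[of i "suffix_sums xs"] that(3) by fastforce
    moreover have "drop (i - 1) xs = xs ! (i - 1) # drop i xs"
      using that Cons_nth_drop_Suc[of "i - 1" xs] by simp
    then have "suffix_sums xs ! (i - 1) = xs ! (i - 1) + suffix_sums xs ! i"
      using that by (simp add: nth_suffix_sums)
    ultimately show ?thesis using that by simp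
  qed
  have last: "xs ! (k - 1) = map (\<lambda>x. x - 1) (suffix_sums xs) ! (k - 1) + 1"
    if "\<forall>x\<in>set xs. 0 < x" "1 \<le> k" "k = length xs" for k and xs :: "nat list"
  proof -
    have "drop (k - 1) xs = [xs ! (k - 1)]"
      using that Cons_nth_drop_Suc[of "k - 1" xs] by simp
    moreover have "0 < xs ! (k - 1)" using that by simp
    ultimately show ?thesis using that by (simp add: nth_suffix_sums)
  qed
  have pos: "\<forall>d\<in>set ds. 0 < d" "\<forall>e\<in>set es. 0 < e" using assms(1) by (auto simp: runs_def)
  have "comp_of_frobenius (length ds)
      (\<lambda>i. map (\<lambda>x. x - 1) (suffix_sums ds) ! (i - 1)) (\<lambda>i. map (\<lambda>x. x - 1) (suffix_sums es) ! (i - 1)) =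
    ds ! (1 - 1) # replicate (es ! (1 - 1) - 1) 1 @
      concat (map (\<lambda>i. (ds ! (i - 1) + 1) # replicate (es ! (i - 1) - 1) 1) [2..<Suc (length ds)])"
    by (rule comp_of_frobenius_eq_decomposition[OF k])
      (rule step last; use pos k len in simp)+
  also have "\<dots> = comp_of_runs (ds, es)"
    using decomposition_eq_comp_of_runs[OF k, of "\<lambda>i. ds ! (i - 1)" "\<lambda>i. es ! (i - 1)"]
      map_nth_pred[of ds] map_nth_pred[of es] by (simp only: len)
  finally show ?thesis .
qed

text \<open>The symbol of the image of a composition lists D_j - 1 and E_j - 1; taking differences
  recovers the runs and with them the preimage.\<close>

lemma part_to_comp_frobenius:
  assumes "r \<le> n" "lam \<in> Part r n" "lam \<noteq> []" "frobenius lam = (As, Ls)"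
  shows "part_to_comp r n lam = comp_of_frobenius (length As) (\<lambda>i. As ! (i - 1)) (\<lambda>i. Ls ! (i - 1))"
proof -
  note bij = bij_betw_comp_to_part[OF assms(1)]
  then obtain \<alpha> where \<alpha>: "\<alpha> \<in> Comp r n" "lam = comp_to_part r n \<alpha>"
    using assms(2) by (auto simp: bij_betw_def)
  have inv: "part_to_comp r n lam = \<alpha>"
    using bij \<alpha> by (auto simp: part_to_comp_def bij_betw_def the_inv_into_f_f)
  obtain ds es where runs: "(ds, es) \<in> runs r n" and \<alpha>_eq: "\<alpha> = comp_of_runs (ds, es)"
    using \<alpha>(1) by (rule Comp_obtain_runs)
  have "As = map (\<lambda>x. x - 1) (suffix_sums ds)" "Ls = map (\<lambda>x. x - 1) (suffix_sums es)"
    using frobenius_comp_to_part[OF runs assms(1)] assms(4) \<alpha>(2) \<alpha>_eq by auto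
  \<comment> \<open>Without runs the composition would be empty and \<open>OHL\<close> would vanish,
    which it does not for a nonempty partition.\<close>
  moreover have "ds \<noteq> []"
  proof
    assume "ds = []"
    then have "\<alpha> = []" using comp_of_runs_eq_Nil_iff[OF runs] \<alpha>_eq by simp
    then have "OHL lam = 0" using sum_list_eq_OHL[OF \<alpha>(1) assms(1)] \<alpha>(2) by simp
    moreover have "0 < hd lam" using assms(2,3) by (auto simp: Part_def Suc_le_eq)
    ultimately show False using assms(3) by (cases lam) (auto simp: OHL_def)
  qed
  ultimately show ?thesis
    using comp_of_frobenius_suffix_sums[OF runs] inv \<alpha>_eq by simp
qed

theorem theorem3p8:
  fixes r n :: nat
  assumes "r \<le> n"
  shows
    "bij_betw (part_of_set r) (rsubsets r n) (Part r n) \<and>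
     bij_betw (comp_of_set r n) (rsubsets r n) (Comp r n) \<and>
     bij_betw (comp_to_part r n) (Comp r n) (Part r n) \<and>
     (\<forall>\<alpha>\<in>Comp r n. \<alpha> \<noteq> [] \<longrightarrow>
        (\<exists>k d e. is_decomposition \<alpha> k d e) \<and>
        (\<forall>k d e. is_decomposition \<alpha> k d e \<longrightarrow>
           (\<forall>a \<beta>. 1 \<le> a \<and> \<alpha> = replicate a 1 @ \<beta> \<and> (\<beta> = [] \<or> hd \<beta> \<noteq> 1) \<longrightarrow> d 1 = 1 \<and> e 1 = a) \<and>
           frobenius (comp_to_part r n \<alpha>) =
             (map (\<lambda>j. (\<Sum>i=j..k. d i) - 1) [1..<Suc k],
              map (\<lambda>j. (\<Sum>i=j..k. e i) - 1) [1..<Suc k]))) \<and>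
     (\<forall>lam\<in>Part r n. lam \<noteq> [] \<longrightarrow>
        (\<forall>As Ls. frobenius lam = (As, Ls) \<longrightarrow>
           part_to_comp r n lam =
             comp_of_frobenius (length As) (\<lambda>i. As ! (i - 1)) (\<lambda>i. Ls ! (i - 1)))) \<and>
     (\<forall>\<alpha>\<in>Comp r n. sum_list \<alpha> = OHL (comp_to_part r n \<alpha>))"
proof (intro conjI ballI impI allI)
  fix \<alpha> k d e
  assume \<alpha>: "\<alpha> \<in> Comp r n" and dec: "is_decomposition \<alpha> k d e"
  show "frobenius (comp_to_part r n \<alpha>) =
      (map (\<lambda>j. (\<Sum>i=j..k. d i) - 1) [1..<Suc k], map (\<lambda>j. (\<Sum>i=j..k. e i) - 1) [1..<Suc k])"
    using frobenius_comp_to_part[OF decomposition_runs(1)[OF dec \<alpha>] assms]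
    unfolding decomposition_runs(2)[OF dec \<alpha>, symmetric] suffix_sums_map_upt
    by (simp add: o_def del: upt_Suc)
  fix a \<beta>
  assume "1 \<le> a \<and> \<alpha> = replicate a 1 @ \<beta> \<and> (\<beta> = [] \<or> hd \<beta> \<noteq> 1)"
  then show "d 1 = 1" "e 1 = a" using decomposition_initial_ones[OF dec, of a \<beta>] by auto
next
  fix \<alpha> assume "\<alpha> \<in> Comp r n" "\<alpha> \<noteq> []"
  then show "\<exists>k d e. is_decomposition \<alpha> k d e" by (rule decomposition_exists)
next
  fix lam As Ls
  assume "lam \<in> Part r n" "lam \<noteq> []" "frobenius lam = (As, Ls)"
  then show "part_to_comp r n lam = comp_of_frobenius (length As) (\<lambda>i. As ! (i - 1)) (\<lambda>i. Ls ! (i - 1))"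
    by (rule part_to_comp_frobenius[OF assms])
qed (use assms in \<open>simp_all add: bij_betw_part_of_set bij_betw_comp_of_set bij_betw_comp_to_part
       sum_list_eq_OHL\<close>)

end
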